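(* Fix $\vartheta>0$ and let $I_n^{(\vartheta)}$ be the internal path length of a Hoppe tree with parameter $\vartheta$ and $n$ nodes (the trees for $n=1,2,\ldots$ being generated by one growth process). Then $$\frac{I_n^{(\vartheta)}-n\log n}{n} \to X^{(\vartheta)}$$ almost surely and in $L_2$, for a non-degenerate random variable $X^{(\vartheta)}$. The distribution $\mathcal{L}(X^{(\vartheta)})$ is the only integrable solution of the distributional fixed point equation $$X^{(\vartheta)} \stackrel{d}{=} (1-B)X^{(\vartheta)}+ B \widetilde{X}^{(1)} + B\log(B)+(1-B)\log(1-B)+B,$$ where $X^{(\vartheta)}$, $\widetilde{X}^{(1)}$ and $B$ are independent, $B$ has the beta$(1,\vartheta)$ distribution, and $\widetilde{X}^{(1)}$ is distributed as $X^{(1)}$ (the corresponding limit for $\vartheta=1$). For $\vartheta\neq 1$, the solution of this fixed point equation is unique even without the integrability assumption.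
   Context: Hoppe tree with parameter $\vartheta>0$: the tree is grown by successive insertion of nodes, all on one probability space. Initially there is only the root. In each step a parent node is chosen among the existing nodes, independently of the past, with probability proportional to its weight, where the root has weight $\vartheta$ and every other node has weight $1$; a new node is attached as a child of the chosen node. The internal path length is the sum over all nodes of their distances to the root. For $\vartheta=1$ the tree is the random recursive tree. The beta$(1,\vartheta)$ distribution has Lebesgue density $x\mapsto \vartheta(1-x)^{\vartheta-1}$ on $[0,1]$. *)

theory Defs
  imports "HOL-Probability.Probability"
begin

text \<open>Nodes of the Hoppe tree are labelled 0,1,2,... in order of insertion; node 0 is the root.
  A growth process is described by the parent map p: node k (k >= 1) is a child of p k < k.\<close>

text \<open>Weight-based selection probability numerator: with k existing nodes 0..k-1,
  the root has weight theta, every other existing node weight 1; total weight theta + k - 1.\<close>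
definition hoppe_weight :: "real \<Rightarrow> nat \<Rightarrow> nat \<Rightarrow> real" where
  "hoppe_weight \<theta> k j = (if j = 0 then \<theta> else if j < k then 1 else 0)"

definition hoppe_process :: "'a measure \<Rightarrow> (nat \<Rightarrow> 'a \<Rightarrow> nat) \<Rightarrow> real \<Rightarrow> bool" where
  "hoppe_process M P \<theta> \<longleftrightarrow>
     prob_space M \<and>
     (\<forall>k. P k \<in> measurable M (count_space UNIV)) \<and>
     prob_space.indep_vars M (\<lambda>_. count_space UNIV) P {1..} \<and>
     (\<forall>k\<ge>1. \<forall>j. measure M {\<omega> \<in> space M. P k \<omega> = j} = hoppe_weight \<theta> k j / (\<theta> + real k - 1))"

function depth :: "(nat \<Rightarrow> nat) \<Rightarrow> nat \<Rightarrow> nat" where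
  "depth p k = (if k = 0 then 0 else if p k < k then Suc (depth p (p k)) else 0)"
  by auto
termination by (relation "Wellfounded.measure snd") auto

definition ipl :: "(nat \<Rightarrow> nat) \<Rightarrow> nat \<Rightarrow> nat" where
  "ipl p n = (\<Sum>k<n. depth p k)"

definition norm_ipl :: "(nat \<Rightarrow> 'a \<Rightarrow> nat) \<Rightarrow> nat \<Rightarrow> 'a \<Rightarrow> real" where
  "norm_ipl P n \<omega> = (real (ipl (\<lambda>k. P k \<omega>) n) - real n * ln (real n)) / real n"

definition beta1 :: "real \<Rightarrow> real measure" where
  "beta1 \<theta> = density lborel (\<lambda>x. ennreal (indicator {0..1} x * \<theta> * (1 - x) powr (\<theta> - 1)))"

definition fp_map :: "real \<times> real \<times> real \<Rightarrow> real" where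
  "fp_map = (\<lambda>(y, z, b). (1 - b) * y + b * z + b * ln b + (1 - b) * ln (1 - b) + b)"

definition fp_solution :: "real \<Rightarrow> real measure \<Rightarrow> real measure \<Rightarrow> bool" where
  "fp_solution \<theta> \<nu> \<mu> \<longleftrightarrow> distr (\<mu> \<Otimes>\<^sub>M (\<nu> \<Otimes>\<^sub>M beta1 \<theta>)) borel fp_map = \<mu>"

definition real_prob_law :: "real measure \<Rightarrow> bool" where
  "real_prob_law \<mu> \<longleftrightarrow> prob_space \<mu> \<and> sets \<mu> = sets borel"

end

theory Submission
  imports Defs "HOL-Real_Asymp.Real_Asymp"
begin

text \<open>Let h(n) be the sum of 1/(theta + k) over k = 1, ..., n - 1. Then I_n/(theta + n - 1) - h(n) is a
  martingale. Its increments have second moments of order (log n / n)^2, so it converges in L2, and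
  almost surely along the squares n = j^2; since I_n is monotone in n, the almost sure convergence
  extends to all n. For the fixed point equation the tree is split into the subtree of node 1, a
  random recursive tree whose size is driven by a Polya urn, and the remaining Hoppe tree. The
  relative subtree size converges weakly to beta(1, theta), and the recursion for the characteristic
  functions of the normalised path lengths passes to the limit.\<close>

section \<open>Node depths and the one-step expectation\<close>

text \<open>The future of the path length depends on the tree only through the multiset of node
  depths, so the growth is encoded by one linear operator \<open>grow\<close> on functions of such
  multisets. Its iterates give every expectation (\<open>integral_D\<close>), and the split at node
  1 becomes an identity between iterates: no subtree or conditional law has to be built on the given
  probability space. Single increments of the martingale are of order log n / n in L2, which is not
  summable; over a block from j^2 to (j+1)^2 orthogonality gives about log j / j^(3/2), which is. At
  the same time the ratio of consecutive squares tends to 1 fast enough to beat log n, which a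
  geometric subsequence would not achieve. Uniqueness has to reach laws without moments, so laws are
  compared through characteristic functions and not through a moment metric. The law of the second
  summand is fixed in the equation; hence the equation is linear in the unknown law, and the
  difference of two solutions obeys an averaging inequality.\<close>

declare depth.simps [simp del]

lemma depth_0 [simp]: "depth p 0 = 0"
  by (simp add: depth.simps)

text \<open>Only the parents of the nodes 1, ..., k matter, which later makes depths functions of
  the finite vector \<open>past\<close>.\<close>

lemma depth_cong: "(\<And>i. 1 \<le> i \<Longrightarrow> i \<le> k \<Longrightarrow> p i = q i) \<Longrightarrow> depth p k = depth q k"
proof (induction k rule: less_induct)
  case (less k)
  show ?case
  proof (cases "k = 0")
    case False
    then have eq: "p k = q k"
      using less.prems by simp
    have "depth p (p k) = depth q (p k)" if "p k < k"
      using that less.prems by (intro less.IH) (meson less_imp_le le_trans)+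
    then show ?thesis
      using eq by (subst (1 2) depth.simps) auto
  qed simp
qed

definition depths :: "(nat \<Rightarrow> nat) \<Rightarrow> nat \<Rightarrow> nat multiset" where
  "depths p n = image_mset (depth p) (mset_set {..<n})"

lemma size_depths [simp]: "size (depths p n) = n"
  by (simp add: depths_def)

lemma depths_1 [simp]: "depths p (Suc 0) = {#0#}"
  by (simp add: depths_def lessThan_Suc)

lemma depths_Suc: "1 \<le> n \<Longrightarrow> p n < n \<Longrightarrow> depths p (Suc n) = add_mset (Suc (depth p (p n))) (depths p n)"
  by (simp add: depths_def lessThan_Suc depth.simps[of p n])

lemma ipl_eq_sum_depths: "ipl p n = \<Sum>\<^sub># (depths p n)"
  by (simp add: ipl_def depths_def sum_unfold_sum_mset)

text \<open>The conditional expectation of F after one more insertion, given the multiset A of node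
  depths. The multiset contains the root as a single 0; its remaining weight is the \<^term>\<open>\<theta> - 1\<close>.\<close>

definition grow :: "real \<Rightarrow> (nat multiset \<Rightarrow> 'b::real_vector) \<Rightarrow> nat multiset \<Rightarrow> 'b" where
  "grow \<theta> F A = ((\<theta> - 1) *\<^sub>R F (add_mset 1 A) + (\<Sum>d\<in>#A. F (add_mset (Suc d) A))) /\<^sub>R (\<theta> + real (size A) - 1)"

lemma grow_depths:
  assumes "1 \<le> n"
  shows "grow \<theta> F (depths p n) =
    (\<Sum>j<n. (hoppe_weight \<theta> n j / (\<theta> + real n - 1)) *\<^sub>R F (add_mset (Suc (depth p j)) (depths p n)))"
proof -
  let ?G = "\<lambda>j. F (add_mset (Suc (depth p j)) (depths p n))"
  \<comment> \<open>The root weight \<open>\<theta>\<close> is written as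
    \<open>(\<theta> - 1) + 1\<close>, so that the unit weights form a uniform sum over all
    nodes.\<close>
  have "(\<Sum>j<n. hoppe_weight \<theta> n j *\<^sub>R ?G j) = (\<Sum>j<n. (if j = 0 then (\<theta> - 1) *\<^sub>R ?G j else 0) + ?G j)"
    by (intro sum.cong) (auto simp: hoppe_weight_def algebra_simps)
  also have "\<dots> = (\<theta> - 1) *\<^sub>R ?G 0 + (\<Sum>j<n. ?G j)"
    using assms by (simp add: sum.distrib)
  also have "(\<Sum>j<n. ?G j) = (\<Sum>d\<in>#depths p n. F (add_mset (Suc d) (depths p n)))"
    by (simp add: depths_def sum_unfold_sum_mset image_mset.compositionality o_def)
  finally have "grow \<theta> F (depths p n) = (\<Sum>j<n. hoppe_weight \<theta> n j *\<^sub>R ?G j) /\<^sub>R (\<theta> + real n - 1)"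
    by (simp add: grow_def)
  then show ?thesis
    by (simp add: scaleR_right.sum divide_inverse mult.commute)
qed

section \<open>Conditional expectations along the growth process\<close>

locale hoppe_tree = prob_space M for M :: "'a measure" +
  fixes P :: "nat \<Rightarrow> 'a \<Rightarrow> nat" and \<theta> :: real
  assumes theta_pos: "\<theta> > 0"
    and process: "hoppe_process M P \<theta>"
begin

lemma P_measurable [measurable]: "P k \<in> M \<rightarrow>\<^sub>M count_space UNIV"
  using process by (simp add: hoppe_process_def)

lemma prob_parent:
  "1 \<le> k \<Longrightarrow> prob {\<omega> \<in> space M. P k \<omega> = j} = hoppe_weight \<theta> k j / (\<theta> + real k - 1)"
  using process by (simp add: hoppe_process_def)

text \<open>\<open>hoppe_process\<close> prescribes only the laws of the parents, so the parent map
  describes a tree only almost surely; in each step countably many values of probability 0 are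
  excluded.\<close>

lemma AE_parent_less: "AE \<omega> in M. \<forall>k\<ge>1. P k \<omega> < k"
proof -
  have "AE \<omega> in M. k \<ge> 1 \<longrightarrow> P k \<omega> < k" for k
  proof (cases "1 \<le> k")
    case k: True
    have "AE \<omega> in M. \<forall>j. j \<ge> k \<longrightarrow> P k \<omega> \<noteq> j"
      unfolding AE_all_countable
    proof (intro allI)
      fix j
      show "AE \<omega> in M. j \<ge> k \<longrightarrow> P k \<omega> \<noteq> j"
      proof (cases "j \<ge> k")
        case True
        then have "prob {\<omega> \<in> space M. P k \<omega> = j} = 0"
          using k by (simp add: prob_parent hoppe_weight_def)
        then show ?thesis
          by (simp add: prob_eq_0)
      qed simp
    qed
    then show ?thesis
      by eventually_elim (auto simp: not_le[symmetric])
  qed simp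
  then show ?thesis
    by (simp add: AE_all_countable)
qed

definition past :: "nat \<Rightarrow> 'a \<Rightarrow> nat \<Rightarrow> nat" where
  "past n \<omega> = restrict (\<lambda>i. P i \<omega>) {1..<n}"

text \<open>A finite product of countable discrete spaces is again discrete, so every function on it
  is measurable.\<close>

lemma past_function_measurable:
  "G \<in> (\<Pi>\<^sub>M i\<in>{1..<n::nat}. count_space (UNIV :: nat set)) \<rightarrow>\<^sub>M borel"
proof -
  have "(\<Pi>\<^sub>M i\<in>{1..<n}. count_space (UNIV :: nat set)) = count_space (\<Pi>\<^sub>E i\<in>{1..<n}. UNIV)"
    by (rule count_space_PiM_finite) auto
  then show ?thesis
    by simp
qed

lemma past_measurable: "past n \<in> M \<rightarrow>\<^sub>M (\<Pi>\<^sub>M i\<in>{1..<n}. count_space UNIV)"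
  unfolding past_def by measurable

lemma borel_measurable_past [measurable]: "(\<lambda>\<omega>. G (past n \<omega>)) \<in> borel_measurable M"
  using measurable_compose[OF past_measurable past_function_measurable] .

text \<open>Almost surely the past lies in a finite set of tuples, so every function of it is
  essentially bounded.\<close>

lemma integrable_past [simp]:
  fixes G :: "(nat \<Rightarrow> nat) \<Rightarrow> 'b::{banach, second_countable_topology}"
  shows "integrable M (\<lambda>\<omega>. G (past n \<omega>))"
proof (rule integrable_const_bound)
  let ?S = "PiE {1..<n} (\<lambda>k. {..<k})"
  have fin: "finite ?S"
    by (intro finite_PiE) auto
  show "AE \<omega> in M. norm (G (past n \<omega>)) \<le> Max ((\<lambda>r. norm (G r)) ` ?S)"
    using AE_parent_less
  proof eventually_elim
    case (elim \<omega>)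
    then have "past n \<omega> \<in> ?S"
      by (auto simp: past_def)
    then show ?case
      using fin by (intro Max_ge) auto
  qed
qed measurable

lemma depth_past: "k < n \<Longrightarrow> depth (past n \<omega>) k = depth (\<lambda>i. P i \<omega>) k"
  by (rule depth_cong) (auto simp: past_def)

lemma depths_past: "m \<le> n \<Longrightarrow> depths (past n \<omega>) m = depths (\<lambda>i. P i \<omega>) m"
  unfolding depths_def by (intro image_mset_cong) (auto simp: depth_past)

abbreviation D :: "nat \<Rightarrow> 'a \<Rightarrow> nat multiset" where
  "D n \<omega> \<equiv> depths (\<lambda>i. P i \<omega>) n"

lemma borel_measurable_D [measurable]: "(\<lambda>\<omega>. F (D n \<omega>)) \<in> borel_measurable M"
  using borel_measurable_past[of "\<lambda>r. F (depths r n)" n] by (simp add: depths_past)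

lemma integrable_D [simp]:
  fixes F :: "nat multiset \<Rightarrow> 'b::{banach, second_countable_topology}"
  shows "integrable M (\<lambda>\<omega>. F (D n \<omega>))"
  using integrable_past[of "\<lambda>r. F (depths r n)" n] by (simp add: depths_past)

text \<open>The past and the parent \<open>P n\<close> use disjoint index sets of the independent
  family.\<close>

lemma integral_past_parent:
  fixes G :: "(nat \<Rightarrow> nat) \<Rightarrow> 'b::{banach, real_normed_field, second_countable_topology}"
  assumes "1 \<le> n"
  shows "(\<integral>\<omega>. G (past n \<omega>) * of_bool (P n \<omega> = j) \<partial>M)
    = of_real (hoppe_weight \<theta> n j / (\<theta> + real n - 1)) * (\<integral>\<omega>. G (past n \<omega>) \<partial>M)"
proof -
  have 1: "indep_var (PiM {1..<n} (\<lambda>_. count_space UNIV)) (past n)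
      (PiM {n} (\<lambda>_. count_space UNIV)) (\<lambda>\<omega>. restrict (\<lambda>i. P i \<omega>) {n})"
    unfolding past_def using process assms
    by (intro indep_var_restrict[where I = "{1..}"]) (auto simp: hoppe_process_def)
  have "indep_var borel (G \<circ> past n) borel ((\<lambda>r. of_bool (r n = j)) \<circ> (\<lambda>\<omega>. restrict (\<lambda>i. P i \<omega>) {n}))"
    by (rule indep_var_compose[OF 1 past_function_measurable]) measurable
  then have "indep_var borel (\<lambda>\<omega>. G (past n \<omega>)) borel (\<lambda>\<omega>. of_bool (P n \<omega> = j) :: 'b)"
    by (simp add: o_def)
  then have "(\<integral>\<omega>. G (past n \<omega>) * of_bool (P n \<omega> = j) \<partial>M)
      = (\<integral>\<omega>. G (past n \<omega>) \<partial>M) * (\<integral>\<omega>. of_bool (P n \<omega> = j) \<partial>M)"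
    by (rule indep_var_lebesgue_integral) (auto intro!: integrable_const_bound[where B = 1])
  also have "(\<integral>\<omega>. (of_bool (P n \<omega> = j) :: 'b) \<partial>M) = (\<integral>\<omega>. indicator {\<omega> \<in> space M. P n \<omega> = j} \<omega> *\<^sub>R 1 \<partial>M)"
    by (intro Bochner_Integration.integral_cong) (auto simp: indicator_def)
  also have "\<dots> = of_real (prob {\<omega> \<in> space M. P n \<omega> = j})"
    by (subst integral_scaleR_left) (auto simp: of_real_def less_top[symmetric])
  finally show ?thesis
    using assms by (simp add: prob_parent mult.commute)
qed

text \<open>This makes \<open>grow \<theta> F (D n \<omega>)\<close> the conditional expectation of
  \<open>F (D (Suc n) \<omega>)\<close> given the past, with \<open>G\<close> as an arbitrary test
  function. The proof decomposes by the value \<open>j\<close> of the new parent, which determines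
  the new depth.\<close>

lemma integral_grow:
  fixes F :: "nat multiset \<Rightarrow> 'b::{banach, real_normed_field, second_countable_topology}"
  assumes n: "1 \<le> n"
  shows "(\<integral>\<omega>. G (past n \<omega>) * F (D (Suc n) \<omega>) \<partial>M) = (\<integral>\<omega>. G (past n \<omega>) * grow \<theta> F (D n \<omega>) \<partial>M)"
proof -
  define H where "H j r = G r * F (add_mset (Suc (depth r j)) (depths r n))" for j r
  have int: "integrable M (\<lambda>\<omega>. H j (past n \<omega>) * of_bool (P n \<omega> = j))" for j
    by (rule Bochner_Integration.integrable_bound[OF integrable_past[of "H j" n]]) auto
  have H: "H j (past n \<omega>) = G (past n \<omega>) * F (add_mset (Suc (depth (\<lambda>i. P i \<omega>) j)) (D n \<omega>))" if "j < n" for j \<omega>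
    using that by (simp add: H_def depth_past depths_past)
  have "(\<integral>\<omega>. G (past n \<omega>) * F (D (Suc n) \<omega>) \<partial>M) = (\<integral>\<omega>. (\<Sum>j<n. H j (past n \<omega>) * of_bool (P n \<omega> = j)) \<partial>M)"
  proof (rule integral_cong_AE)
    show "AE \<omega> in M. G (past n \<omega>) * F (D (Suc n) \<omega>) = (\<Sum>j<n. H j (past n \<omega>) * of_bool (P n \<omega> = j))"
      using AE_parent_less
    proof eventually_elim
      case (elim \<omega>)
      then have "P n \<omega> < n"
        using n by blast
      then show ?case
        using n by (simp add: depths_Suc H of_bool_def if_distrib cong: if_cong)
    qed
  qed measurable
  also have "\<dots> = (\<Sum>j<n. of_real (hoppe_weight \<theta> n j / (\<theta> + real n - 1)) * (\<integral>\<omega>. H j (past n \<omega>) \<partial>M))"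
    using n int by (subst Bochner_Integration.integral_sum) (auto simp: integral_past_parent simp del: of_real_divide sum_mult_of_bool_eq)
  also have "\<dots> = (\<integral>\<omega>. (\<Sum>j<n. of_real (hoppe_weight \<theta> n j / (\<theta> + real n - 1)) * H j (past n \<omega>)) \<partial>M)"
    by (subst Bochner_Integration.integral_sum) (auto simp del: of_real_divide)
  also have "\<dots> = (\<integral>\<omega>. G (past n \<omega>) * grow \<theta> F (D n \<omega>) \<partial>M)"
    using n by (intro Bochner_Integration.integral_cong refl)
      (simp add: grow_depths H sum_distrib_left scaleR_conv_of_real mult.left_commute del: of_real_divide)
  finally show ?thesis .
qed

lemma integral_D_Suc:
  fixes F :: "nat multiset \<Rightarrow> 'b::{banach, real_normed_field, second_countable_topology}"
  shows "1 \<le> n \<Longrightarrow> (\<integral>\<omega>. F (D (Suc n) \<omega>) \<partial>M) = (\<integral>\<omega>. grow \<theta> F (D n \<omega>) \<partial>M)"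
  using integral_grow[of n "\<lambda>_. 1" F] by simp

text \<open>The right-hand side does not mention the probability space, so expectations for trees on
  different spaces can be combined later.\<close>

lemma integral_D:
  fixes F :: "nat multiset \<Rightarrow> 'b::{banach, real_normed_field, second_countable_topology}"
  shows "(\<integral>\<omega>. F (D (Suc n) \<omega>) \<partial>M) = (grow \<theta> ^^ n) F {#0#}"
proof (induction n arbitrary: F)
  case (Suc n)
  show ?case
    by (simp add: integral_D_Suc Suc.IH funpow_swap1)
qed (simp add: prob_space)

end

section \<open>The path length martingale\<close>

declare of_nat_sum_mset [simp del]

text \<open>The sum starts at 1, so that it vanishes for a single node and, times the total weight,
  is the mean path length (\<open>expectation_ipl\<close>).\<close>

definition hsum :: "real \<Rightarrow> nat \<Rightarrow> real" where
  "hsum \<theta> n = (\<Sum>k=1..<n. 1 / (\<theta> + real k))"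

definition mart :: "real \<Rightarrow> nat multiset \<Rightarrow> real" where
  "mart \<theta> A = real (\<Sum>\<^sub># A) / (\<theta> + real (size A) - 1) - hsum \<theta> (size A)"

abbreviation sqsum :: "nat multiset \<Rightarrow> nat" where
  "sqsum A \<equiv> (\<Sum>d\<in>#A. d\<^sup>2)"

lemma hsum_Suc: "1 \<le> n \<Longrightarrow> hsum \<theta> (Suc n) = hsum \<theta> n + 1 / (\<theta> + real n)"
  by (simp add: hsum_def)

lemma hsum_1 [simp]: "hsum \<theta> (Suc 0) = 0"
  by (simp add: hsum_def)

lemma hsum_nonneg: "\<theta> > 0 \<Longrightarrow> hsum \<theta> n \<ge> 0"
  by (auto simp: hsum_def intro!: sum_nonneg)

text \<open>The limit formula for \<open>Digamma \<theta>\<close> includes the term for 0; removing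
  it accounts for the \<open>1 / \<theta>\<close>.\<close>

lemma hsum_minus_ln_convergent:
  assumes "\<theta> > 0"
  shows "convergent (\<lambda>n. hsum \<theta> n - ln (real n))"
proof -
  have "hsum \<theta> n - ln (real n) = - (ln (real n) - (\<Sum>k<n. inverse (\<theta> + real k))) - 1 / \<theta>" if "n > 0" for n
  proof -
    have "{..<n} = insert 0 {1..<n}"
      using that by auto
    then have "(\<Sum>k<n. inverse (\<theta> + real k)) = 1 / \<theta> + hsum \<theta> n"
      by (simp add: hsum_def inverse_eq_divide)
    then show ?thesis
      by simp
  qed
  then have "\<forall>\<^sub>F n in sequentially. - (ln (real n) - (\<Sum>k<n. inverse (\<theta> + real k))) - 1 / \<theta> = hsum \<theta> n - ln (real n)"
    by (intro eventually_sequentiallyI[of 1]) auto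
  moreover have "(\<lambda>n. - (ln (real n) - (\<Sum>k<n. inverse (\<theta> + real k))) - 1 / \<theta>) \<longlonglongrightarrow> - Digamma \<theta> - 1 / \<theta>"
    using Digamma_LIMSEQ[of \<theta>] assms by (intro tendsto_intros) auto
  ultimately show ?thesis
    by (rule convergentI[OF Lim_transform_eventually[rotated]])
qed

text \<open>A power replaces the logarithm in the later estimates. Any exponent below 1/4 would
  serve: the increments of \<open>msq\<close> must decay faster than the power -3/2 for the block
  argument along the squares.\<close>

lemma hsum_bound:
  assumes "\<theta> > 0"
  obtains K where "K > 0" "\<And>n. n \<ge> 1 \<Longrightarrow> hsum \<theta> n \<le> K * real n powr (1/8)"
proof -
  obtain K where K: "K > 0" "\<And>n. \<bar>hsum \<theta> n - ln (real n)\<bar> \<le> K"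
    using convergent_imp_Bseq[OF hsum_minus_ln_convergent[OF assms]] unfolding Bseq_def by auto
  have "hsum \<theta> n \<le> (K + 8) * real n powr (1/8)" if "n \<ge> 1" for n
  proof -
    have "hsum \<theta> n \<le> K + ln (real n)"
      using K(2)[of n] by linarith
    also have "ln (real n) \<le> 8 * real n powr (1/8)"
      using ln_powr_bound[of "real n" "1/8"] that by simp
    also have "K \<le> K * real n powr (1/8)"
      using K that by (simp add: ge_one_powr_ge_zero)
    finally show ?thesis
      by (simp add: algebra_simps)
  qed
  then show ?thesis
    using K by (intro that[of "K + 8"]) auto
qed

text \<open>The fractions multiplied by \<open>v\<close> and \<open>w\<close> are the first and
  second moments of the depth of the new node.\<close>

lemma grow_quadratic:
  assumes F: "\<And>d. F (add_mset d A) = u + v * real d + w * (real d)\<^sup>2"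
    and W: "W = \<theta> + real (size A) - 1" "W \<noteq> 0"
  shows "grow \<theta> F A = u + v * (W + real (\<Sum>\<^sub># A)) / W + w * (W + real (sqsum A) + 2 * real (\<Sum>\<^sub># A)) / W"
proof -
  have "(\<Sum>d\<in>#B. u + v * real (Suc d) + w * (real (Suc d))\<^sup>2)
      = real (size B) * (u + v + w) + (v + 2 * w) * real (\<Sum>\<^sub># B) + w * real (sqsum B)" for B
    by (induction B) (auto simp: algebra_simps power2_eq_square)
  note * = this[of A]
  have n: "real (size A) = W + 1 - \<theta>"
    using W by simp
  show ?thesis
    unfolding grow_def F * unfolding n using W(2)
    by (simp add: field_simps)
qed

context
  fixes \<theta> :: real
  assumes th: "\<theta> > 0"
begin

lemma mart_add_mset:
  assumes "W = \<theta> + real (size A) - 1" "A \<noteq> {#}"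
  shows "mart \<theta> (add_mset d A) = (real (\<Sum>\<^sub># A) / (W + 1) - hsum \<theta> (Suc (size A))) + 1 / (W + 1) * real d"
  using assms by (simp add: mart_def add_divide_distrib)

lemma weight_pos: "A \<noteq> {#} \<Longrightarrow> \<theta> + real (size A) - 1 > 0"
  using th by (cases A) auto

text \<open>The martingale property as arithmetic: the depth of the new node is replaced by its
  mean, and the new term of \<open>hsum\<close> cancels the drift.\<close>

lemma mart_shift:
  assumes W: "W = \<theta> + real (size A) - 1" and A: "A \<noteq> {#}"
  shows "real (\<Sum>\<^sub># A) / (W + 1) - hsum \<theta> (Suc (size A)) + (W + real (\<Sum>\<^sub># A)) / (W * (W + 1)) = mart \<theta> A"
proof -
  have "1 \<le> size A"
    using A by (cases A) auto
  moreover have "W > 0"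
    using weight_pos[OF A] W by simp
  moreover have "\<theta> + real (size A) = W + 1"
    using W by simp
  moreover have "x / (W + 1) + (W + x) / (W * (W + 1)) = x / W + 1 / (W + 1)" if "W > 0" for x
    using that by (simp add: divide_simps) (simp add: algebra_simps)
  note this[of "real (\<Sum>\<^sub># A)"]
  ultimately show ?thesis
    by (simp add: mart_def W[symmetric] hsum_Suc)
qed

lemma grow_mart:
  assumes "A \<noteq> {#}"
  shows "grow \<theta> (mart \<theta>) A = mart \<theta> A"
proof -
  let ?W = "\<theta> + real (size A) - 1"
  let ?c = "real (\<Sum>\<^sub># A) / (?W + 1) - hsum \<theta> (Suc (size A))"
  have "grow \<theta> (mart \<theta>) A = ?c + 1 / (?W + 1) * (?W + real (\<Sum>\<^sub># A)) / ?W + 0 * (?W + real (sqsum A) + 2 * real (\<Sum>\<^sub># A)) / ?W"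
    using weight_pos[OF assms] by (intro grow_quadratic) (simp_all add: mart_add_mset[OF refl assms])
  also have "\<dots> = mart \<theta> A"
    using mart_shift[OF refl assms] by (simp add: mult.commute)
  finally show ?thesis .
qed

text \<open>The correction is the variance of the depth of the new node divided by
  \<open>(W + 1)\<^sup>2\<close>.\<close>

lemma grow_mart_squared:
  assumes A: "A \<noteq> {#}" and W: "W = \<theta> + real (size A) - 1"
  shows "grow \<theta> (\<lambda>A. (mart \<theta> A)\<^sup>2) A = (mart \<theta> A)\<^sup>2
    + (W + real (sqsum A) + 2 * real (\<Sum>\<^sub># A)) / (W * (W + 1)\<^sup>2) - ((W + real (\<Sum>\<^sub># A)) / (W * (W + 1)))\<^sup>2"
proof -
  let ?I = "real (\<Sum>\<^sub># A)"
  define c where "c = ?I / (W + 1) - hsum \<theta> (Suc (size A))"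
  have Wpos: "W > 0"
    using weight_pos[OF A] W by simp
  have "grow \<theta> (\<lambda>A. (mart \<theta> A)\<^sup>2) A = c\<^sup>2 + (2 * c / (W + 1)) * (W + ?I) / W + (1 / (W + 1)\<^sup>2) * (W + real (sqsum A) + 2 * ?I) / W"
  proof (rule grow_quadratic[OF _ W])
    show "(mart \<theta> (add_mset d A))\<^sup>2 = c\<^sup>2 + 2 * c / (W + 1) * real d + 1 / (W + 1)\<^sup>2 * (real d)\<^sup>2" for d
      unfolding mart_add_mset[OF W A] c_def[symmetric] by (simp add: power2_sum power_divide)
  qed (use Wpos in simp)
  also have "\<dots> = (c + (W + ?I) / (W * (W + 1)))\<^sup>2 + (W + real (sqsum A) + 2 * ?I) / (W * (W + 1)\<^sup>2) - ((W + ?I) / (W * (W + 1)))\<^sup>2"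
    by (simp add: power2_sum mult_ac)
  also have "c + (W + ?I) / (W * (W + 1)) = mart \<theta> A"
    unfolding c_def by (rule mart_shift[OF W A])
  finally show ?thesis .
qed

lemma grow_sqsum:
  assumes A: "A \<noteq> {#}" and W: "W = \<theta> + real (size A) - 1"
  shows "grow \<theta> (\<lambda>A. real (sqsum A)) A = real (sqsum A) + (W + real (sqsum A) + 2 * real (\<Sum>\<^sub># A)) / W"
proof -
  have "grow \<theta> (\<lambda>A. real (sqsum A)) A = real (sqsum A) + 0 * (W + real (\<Sum>\<^sub># A)) / W + 1 * (W + real (sqsum A) + 2 * real (\<Sum>\<^sub># A)) / W"
    using weight_pos[OF A] W by (intro grow_quadratic) auto
  then show ?thesis
    by simp
qed

end

text \<open>Sum and integral of nonnegative functions commute, so the sum of the absolute increments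
  has finite expectation and is finite almost surely.\<close>

lemma (in prob_space) AE_convergent_if_summable_increments:
  fixes X :: "nat \<Rightarrow> 'a \<Rightarrow> real"
  assumes int: "\<And>j. integrable M (X j)"
    and sum: "summable (\<lambda>j. expectation (\<lambda>\<omega>. \<bar>X (Suc j) \<omega> - X j \<omega>\<bar>))"
  shows "AE \<omega> in M. convergent (\<lambda>j. X j \<omega>)"
proof -
  note [measurable] = borel_measurable_integrable[OF int]
  let ?Y = "\<lambda>j \<omega>. \<bar>X (Suc j) \<omega> - X j \<omega>\<bar>"
  have "(\<integral>\<^sup>+\<omega>. (\<Sum>j. ennreal (?Y j \<omega>)) \<partial>M) = (\<Sum>j. \<integral>\<^sup>+\<omega>. ennreal (?Y j \<omega>) \<partial>M)"
    by (intro nn_integral_suminf) measurable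
  also have "\<dots> = (\<Sum>j. ennreal (expectation (?Y j)))"
    by (intro suminf_cong nn_integral_eq_integral) (auto intro!: Bochner_Integration.integrable_diff int)
  also have "\<dots> = ennreal (\<Sum>j. expectation (?Y j))"
    by (intro suminf_ennreal2 sum) auto
  finally have "AE \<omega> in M. (\<Sum>j. ennreal (?Y j \<omega>)) \<noteq> \<infinity>"
    by (intro nn_integral_PInf_AE) auto
  then show ?thesis
  proof eventually_elim
    case (elim \<omega>)
    then have "summable (\<lambda>j. ?Y j \<omega>)"
      by (intro summable_suminf_not_top) auto
    then have "summable (\<lambda>j. X (Suc j) \<omega> - X j \<omega>)"
      by (rule summable_rabs_cancel)
    then have "convergent (\<lambda>n. (\<Sum>j<n. X (Suc j) \<omega> - X j \<omega>) + X 0 \<omega>)"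
      by (intro convergent_add convergent_const) (simp add: summable_iff_convergent)
    moreover have "(\<lambda>n. (\<Sum>j<n. X (Suc j) \<omega> - X j \<omega>) + X 0 \<omega>) = (\<lambda>n. X n \<omega>)"
      using sum_lessThan_telescope[of "\<lambda>j. X j \<omega>"] by auto
    ultimately show ?case
      by simp
  qed
qed

lemma (in prob_space) expectation_abs_le_sqrt:
  assumes [measurable]: "random_variable borel X" and "integrable M (\<lambda>\<omega>. (X \<omega>)\<^sup>2)"
  shows "expectation (\<lambda>\<omega>. \<bar>X \<omega>\<bar>) \<le> sqrt (expectation (\<lambda>\<omega>. (X \<omega>)\<^sup>2))"
proof -
  have "integrable M X"
    using square_integrable_imp_integrable assms by blast
  then have "(expectation (\<lambda>\<omega>. \<bar>X \<omega>\<bar>))\<^sup>2 \<le> expectation (\<lambda>\<omega>. \<bar>X \<omega>\<bar>\<^sup>2)"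
    using variance_eq[of "\<lambda>\<omega>. \<bar>X \<omega>\<bar>"] variance_positive[of "\<lambda>\<omega>. \<bar>X \<omega>\<bar>"] assms by simp
  then show ?thesis
    by (simp add: real_le_rsqrt)
qed


section \<open>Second moments of the path length martingale\<close>

context hoppe_tree
begin

abbreviation W :: "nat \<Rightarrow> real" where
  "W n \<equiv> \<theta> + real n - 1"

lemma W_pos: "1 \<le> n \<Longrightarrow> W n > 0"
  using theta_pos by simp

lemma D_nonempty: "1 \<le> n \<Longrightarrow> D n \<omega> \<noteq> {#}"
  using size_depths[of "\<lambda>i. P i \<omega>" n] by (auto simp del: size_depths)

lemma expectation_mart: "1 \<le> n \<Longrightarrow> expectation (\<lambda>\<omega>. mart \<theta> (D n \<omega>)) = 0"
proof (induction n rule: dec_induct)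
  case (step n)
  then show ?case
    using integral_D_Suc[of n "mart \<theta>"] by (simp add: grow_mart[OF theta_pos D_nonempty])
qed (simp add: mart_def)

lemma expectation_ipl:
  assumes "1 \<le> n"
  shows "expectation (\<lambda>\<omega>. real (\<Sum>\<^sub># (D n \<omega>))) = W n * hsum \<theta> n"
proof -
  have "0 = expectation (\<lambda>\<omega>. real (\<Sum>\<^sub># (D n \<omega>)) / W n - hsum \<theta> n)"
    using expectation_mart[OF assms] by (simp add: mart_def)
  also have "\<dots> = expectation (\<lambda>\<omega>. real (\<Sum>\<^sub># (D n \<omega>))) / W n - hsum \<theta> n"
    using integrable_D[of "\<lambda>A. real (\<Sum>\<^sub># A)" n] by (simp add: prob_space)
  finally show ?thesis
    using W_pos[OF assms] by (simp add: field_simps)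
qed

text \<open>After division by \<open>W n\<close> the quantity grows in each step by
  \<open>2 * hsum \<theta> n + 1\<close> times the increment of \<open>hsum\<close>. Since
  \<open>hsum\<close> increases, the sum of these steps is at most the stated product.\<close>

lemma expectation_sqsum_le:
  "1 \<le> n \<Longrightarrow> expectation (\<lambda>\<omega>. real (sqsum (D n \<omega>))) \<le> W n * ((2 * hsum \<theta> n + 1) * hsum \<theta> n)"
proof (induction n rule: dec_induct)
  case (step n)
  let ?h = "hsum \<theta> n" and ?S = "expectation (\<lambda>\<omega>. real (sqsum (D n \<omega>)))"
  have W: "W n > 0"
    using W_pos step by simp
  have "expectation (\<lambda>\<omega>. real (sqsum (D (Suc n) \<omega>)))
      = expectation (\<lambda>\<omega>. real (sqsum (D n \<omega>)) + (W n + real (sqsum (D n \<omega>)) + 2 * real (\<Sum>\<^sub># (D n \<omega>))) / W n)"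
    using step by (subst integral_D_Suc[of n "\<lambda>A. real (sqsum A)"])
      (simp_all add: grow_sqsum[OF theta_pos D_nonempty refl])
  also have "\<dots> = ?S + (W n + ?S + 2 * (W n * ?h)) / W n"
    using step integrable_D[of "\<lambda>A. real (\<Sum>\<^sub># A)" n] integrable_D[of "\<lambda>A. real (sqsum A)" n]
    by (simp add: expectation_ipl[symmetric] prob_space)
  also have "\<dots> = ?S * (1 + 1 / W n) + (1 + 2 * ?h)"
    using W by (simp add: divide_simps) (simp add: algebra_simps)
  also have "?S * (1 + 1 / W n) \<le> (W n * ((2 * ?h + 1) * ?h)) * (1 + 1 / W n)"
    using step.IH W by (intro mult_right_mono) auto
  also have "\<dots> = (W n + 1) * ((2 * ?h + 1) * ?h)"
    using W by (simp add: divide_simps)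
  also have "\<dots> + (1 + 2 * ?h) = (W n + 1) * ((2 * ?h + 1) * (?h + 1 / (W n + 1)))"
    using W by (simp add: divide_simps) (simp add: algebra_simps)
  also have "\<dots> \<le> (W n + 1) * ((2 * (?h + 1 / (W n + 1)) + 1) * (?h + 1 / (W n + 1)))"
    using W hsum_nonneg[OF theta_pos, of n] by (intro mult_left_mono mult_right_mono) auto
  finally show ?case
    using step by (simp add: hsum_Suc)
qed simp

definition msq :: "nat \<Rightarrow> real" where
  "msq n = expectation (\<lambda>\<omega>. (mart \<theta> (D n \<omega>))\<^sup>2)"

text \<open>Orthogonality of the increments: the earlier value is a function of the past, so
  \<open>integral_grow\<close> moves the later one back step by step.\<close>

lemma expectation_mart_mult:
  assumes "1 \<le> n" "n \<le> m"
  shows "expectation (\<lambda>\<omega>. mart \<theta> (D n \<omega>) * mart \<theta> (D m \<omega>)) = msq n"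
  using assms(2)
proof (induction m rule: dec_induct)
  case (step m)
  then show ?case
    using integral_grow[of m "\<lambda>r. mart \<theta> (depths r n)" "mart \<theta>"] assms(1)
    by (simp add: grow_mart[OF theta_pos D_nonempty] depths_past)
qed (simp add: msq_def power2_eq_square)

lemma expectation_mart_diff_squared:
  assumes "1 \<le> n" "n \<le> m"
  shows "integrable M (\<lambda>\<omega>. (mart \<theta> (D m \<omega>) - mart \<theta> (D n \<omega>))\<^sup>2)"
    and "expectation (\<lambda>\<omega>. (mart \<theta> (D m \<omega>) - mart \<theta> (D n \<omega>))\<^sup>2) = msq m - msq n"
proof -
  have int: "integrable M (\<lambda>\<omega>. mart \<theta> (D n \<omega>) * mart \<theta> (D m \<omega>))"
    using integrable_past[of "\<lambda>r. mart \<theta> (depths r n) * mart \<theta> (depths r m)" m] assms(2)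
    by (simp add: depths_past)
  have eq: "(mart \<theta> (D m \<omega>) - mart \<theta> (D n \<omega>))\<^sup>2
      = (mart \<theta> (D m \<omega>))\<^sup>2 + (mart \<theta> (D n \<omega>))\<^sup>2 - 2 * (mart \<theta> (D n \<omega>) * mart \<theta> (D m \<omega>))" for \<omega>
    by (simp add: power2_diff)
  show "integrable M (\<lambda>\<omega>. (mart \<theta> (D m \<omega>) - mart \<theta> (D n \<omega>))\<^sup>2)"
    unfolding eq using integrable_D[of "\<lambda>A. (mart \<theta> A)\<^sup>2"] int by auto
  show "expectation (\<lambda>\<omega>. (mart \<theta> (D m \<omega>) - mart \<theta> (D n \<omega>))\<^sup>2) = msq m - msq n"
    unfolding eq using integrable_D[of "\<lambda>A. (mart \<theta> A)\<^sup>2"] int assms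
    by (simp add: expectation_mart_mult) (simp add: msq_def)
qed

lemma msq_mono: "1 \<le> n \<Longrightarrow> n \<le> m \<Longrightarrow> msq n \<le> msq m"
proof -
  assume "1 \<le> n" "n \<le> m"
  then have "msq m - msq n = expectation (\<lambda>\<omega>. (mart \<theta> (D m \<omega>) - mart \<theta> (D n \<omega>))\<^sup>2)"
    by (simp add: expectation_mart_diff_squared(2))
  also have "\<dots> \<ge> 0"
    by simp
  finally show ?thesis
    by simp
qed

lemma msq_Suc:
  assumes n: "1 \<le> n"
  shows "msq (Suc n) = msq n + expectation (\<lambda>\<omega>.
    (W n + real (sqsum (D n \<omega>)) + 2 * real (\<Sum>\<^sub># (D n \<omega>))) / (W n * (W n + 1)\<^sup>2)
    - ((W n + real (\<Sum>\<^sub># (D n \<omega>))) / (W n * (W n + 1)))\<^sup>2)"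
proof -
  let ?F = "\<lambda>A. (W n + real (sqsum A) + 2 * real (\<Sum>\<^sub># A)) / (W n * (W n + 1)\<^sup>2)
    - ((W n + real (\<Sum>\<^sub># A)) / (W n * (W n + 1)))\<^sup>2"
  have "msq (Suc n) = expectation (\<lambda>\<omega>. (mart \<theta> (D n \<omega>))\<^sup>2 + ?F (D n \<omega>))"
    unfolding msq_def using n by (subst integral_D_Suc[of n "\<lambda>A. (mart \<theta> A)\<^sup>2"])
      (simp_all add: grow_mart_squared[OF theta_pos D_nonempty refl] add_diff_eq)
  also have "\<dots> = msq n + expectation (\<lambda>\<omega>. ?F (D n \<omega>))"
    unfolding msq_def by (rule Bochner_Integration.integral_add[OF integrable_D[of "\<lambda>A. (mart \<theta> A)\<^sup>2"] integrable_D[of ?F]])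
  finally show ?thesis .
qed

text \<open>The variance of the new depth is bounded by its second moment; with
  \<open>expectation_sqsum_le\<close> the factor \<open>W n\<close> then cancels.\<close>

lemma msq_increment_le:
  assumes n: "1 \<le> n"
  shows "msq (Suc n) - msq n \<le> (2 * hsum \<theta> n + 1) * (hsum \<theta> n + 1) / (real n)\<^sup>2"
proof -
  let ?h = "hsum \<theta> n" and ?S = "expectation (\<lambda>\<omega>. real (sqsum (D n \<omega>)))"
  have W: "W n > 0" and h: "?h \<ge> 0"
    using W_pos n hsum_nonneg theta_pos by auto
  have "msq (Suc n) - msq n \<le> expectation (\<lambda>\<omega>. (W n + real (sqsum (D n \<omega>)) + 2 * real (\<Sum>\<^sub># (D n \<omega>))) / (W n * (W n + 1)\<^sup>2))"
  proof -
    let ?F = "\<lambda>A. (W n + real (sqsum A) + 2 * real (\<Sum>\<^sub># A)) / (W n * (W n + 1)\<^sup>2)"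
    let ?G = "\<lambda>A. ?F A - ((W n + real (\<Sum>\<^sub># A)) / (W n * (W n + 1)))\<^sup>2"
    have "expectation (\<lambda>\<omega>. ?G (D n \<omega>)) \<le> expectation (\<lambda>\<omega>. ?F (D n \<omega>))"
      by (rule integral_mono[OF integrable_D[of ?G] integrable_D[of ?F]]) simp
    then show ?thesis
      using msq_Suc[OF n] by linarith
  qed
  also have "\<dots> = (W n + ?S + 2 * (W n * ?h)) / (W n * (W n + 1)\<^sup>2)"
    using n integrable_D[of "\<lambda>A. real (\<Sum>\<^sub># A)" n] integrable_D[of "\<lambda>A. real (sqsum A)" n]
    by (simp add: expectation_ipl[symmetric] prob_space)
  also have "\<dots> \<le> (W n + W n * ((2 * ?h + 1) * ?h) + 2 * (W n * ?h)) / (W n * (W n + 1)\<^sup>2)"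
    using W expectation_sqsum_le[OF n] by (intro divide_right_mono) auto
  also have "\<dots> = W n * ((2 * ?h + 1) * (?h + 1)) / (W n * (W n + 1)\<^sup>2)"
    by (simp add: algebra_simps)
  also have "\<dots> = (2 * ?h + 1) * (?h + 1) / (W n + 1)\<^sup>2"
    using W by (subst mult_divide_mult_cancel_left) auto
  also have "\<dots> \<le> (2 * ?h + 1) * (?h + 1) / (real n)\<^sup>2"
    using n theta_pos h by (intro divide_left_mono power_mono mult_nonneg_nonneg) auto
  finally show ?thesis .
qed

text \<open>Two factors of exponent 1/8 against the exponent -2 give -7/4.\<close>

lemma msq_increment_bound:
  obtains C where "C > 0" "\<And>n. 1 \<le> n \<Longrightarrow> msq (Suc n) - msq n \<le> C * real n powr (-7/4)"
proof -
  obtain K where K: "K > 0" "\<And>n. n \<ge> 1 \<Longrightarrow> hsum \<theta> n \<le> K * real n powr (1/8)"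
    using hsum_bound[OF theta_pos] by blast
  have "msq (Suc n) - msq n \<le> ((2 * K + 1) * (K + 1)) * real n powr (-7/4)" if n: "1 \<le> n" for n
  proof -
    let ?x = "real n powr (1/8)" and ?h = "hsum \<theta> n"
    have "1 \<le> ?x"
      using n by (simp add: ge_one_powr_ge_zero)
    then have "2 * ?h + 1 \<le> (2 * K + 1) * ?x" "?h + 1 \<le> (K + 1) * ?x"
      using K(2)[OF n] by (simp_all add: algebra_simps)
    then have "(2 * ?h + 1) * (?h + 1) \<le> ((2 * K + 1) * ?x) * ((K + 1) * ?x)"
      using hsum_nonneg[OF theta_pos, of n] by (intro mult_mono) auto
    then have "(2 * ?h + 1) * (?h + 1) / (real n)\<^sup>2 \<le> ((2 * K + 1) * ?x) * ((K + 1) * ?x) / (real n)\<^sup>2"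
      by (intro divide_right_mono) auto
    also have "\<dots> = ((2 * K + 1) * (K + 1)) * (?x * ?x / (real n)\<^sup>2)"
      by simp
    also have "?x * ?x / (real n)\<^sup>2 = real n powr (1/8) * real n powr (1/8) * real n powr (-2)"
      using n powr_minus_divide[of "real n" 2] by simp
    also have "\<dots> = real n powr (-7/4)"
      by (simp flip: powr_add)
    finally show ?thesis
      using msq_increment_le[OF n] by linarith
  qed
  then show ?thesis
    using K by (intro that[of "(2 * K + 1) * (K + 1)"]) auto
qed

lemma msq_convergent: "convergent msq"
proof -
  obtain C where C: "C > 0" "\<And>n. 1 \<le> n \<Longrightarrow> msq (Suc n) - msq n \<le> C * real n powr (-7/4)"
    using msq_increment_bound by blast
  have "summable (\<lambda>n. msq (Suc n) - msq n)"
  proof (rule summable_comparison_test')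
    show "summable (\<lambda>n. C * real n powr (-7/4))"
      by (intro summable_mult) (simp add: summable_real_powr_iff)
    show "norm (msq (Suc n) - msq n) \<le> C * real n powr (-7/4)" if "1 \<le> n" for n
      using C(2)[OF that] msq_mono[of n "Suc n"] that by simp
  qed
  then have "convergent (\<lambda>n. (\<Sum>j<n. msq (Suc j) - msq j) + msq 0)"
    by (intro convergent_add convergent_const) (simp add: summable_iff_convergent)
  then show ?thesis
    by (simp add: sum_lessThan_telescope)
qed

text \<open>Two nodes almost surely have the depths 0 and 1, so the third node is the first random
  one: its depth is 1 or 2 with weights \<open>\<theta>\<close> and 1. Monotonicity of
  \<open>msq\<close> preserves this variance.\<close>

lemma msq_pos: "3 \<le> n \<Longrightarrow> 0 < msq 3 \<and> msq 3 \<le> msq n"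
proof
  show "0 < msq 3"
  proof -
    let ?w = "\<theta> + 1"
    have D2: "AE \<omega> in M. D 2 \<omega> = {#1, 0#}"
      using AE_parent_less
    proof eventually_elim
      case (elim \<omega>)
      then have "P 1 \<omega> < 1"
        by blast
      then show ?case
        using depths_Suc[of 1 "\<lambda>i. P i \<omega>"] by (simp add: numeral_2_eq_2)
    qed
    have "msq 3 = msq 2 + expectation (\<lambda>\<omega>.
      (W 2 + real (sqsum (D 2 \<omega>)) + 2 * real (\<Sum>\<^sub># (D 2 \<omega>))) / (W 2 * (W 2 + 1)\<^sup>2)
      - ((W 2 + real (\<Sum>\<^sub># (D 2 \<omega>))) / (W 2 * (W 2 + 1)))\<^sup>2)"
      using msq_Suc[of 2] by (simp add: numeral_3_eq_3 numeral_2_eq_2)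
    also have "expectation (\<lambda>\<omega>.
      (W 2 + real (sqsum (D 2 \<omega>)) + 2 * real (\<Sum>\<^sub># (D 2 \<omega>))) / (W 2 * (W 2 + 1)\<^sup>2)
      - ((W 2 + real (\<Sum>\<^sub># (D 2 \<omega>))) / (W 2 * (W 2 + 1)))\<^sup>2)
      = expectation (\<lambda>\<omega>. (?w + 3) / (?w * (?w + 1)\<^sup>2) - ((?w + 1) / (?w * (?w + 1)))\<^sup>2)"
    proof (rule integral_cong_AE)
      show "(\<lambda>\<omega>. (W 2 + real (sqsum (D 2 \<omega>)) + 2 * real (\<Sum>\<^sub># (D 2 \<omega>))) / (W 2 * (W 2 + 1)\<^sup>2)
        - ((W 2 + real (\<Sum>\<^sub># (D 2 \<omega>))) / (W 2 * (W 2 + 1)))\<^sup>2) \<in> borel_measurable M"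
        by (rule borel_measurable_D)
    qed (use D2 in \<open>auto elim!: eventually_mono simp: add_ac\<close>)
    also have "\<dots> = \<theta> / (?w\<^sup>2 * (?w + 1)\<^sup>2)"
    proof -
      have "(w + 3) / (w * (w + 1)\<^sup>2) - ((w + 1) / (w * (w + 1)))\<^sup>2 = (w - 1) / (w\<^sup>2 * (w + 1)\<^sup>2)" if "w > 0" for w :: real
        using that by (simp add: divide_simps) (simp add: algebra_simps power2_eq_square)
      from this[of ?w] show ?thesis
        using theta_pos by (simp add: prob_space)
    qed
    also have "msq 2 + \<theta> / (?w\<^sup>2 * (?w + 1)\<^sup>2) > 0"
    proof -
      have "msq 2 \<ge> 0"
        by (simp add: msq_def)
      moreover have "\<theta> / (?w\<^sup>2 * (?w + 1)\<^sup>2) > 0"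
        using theta_pos by simp
      ultimately show ?thesis
        by linarith
    qed
    finally show ?thesis .
  qed
qed (rule msq_mono, auto)

end

text \<open>Between consecutive squares the normalisation changes by a vanishing amount, so monotonicity
  transfers the limit along the squares to the whole sequence.\<close>

lemma tendsto_from_squares:
  fixes I :: "nat \<Rightarrow> real"
  assumes mono: "mono I"
    and lim: "(\<lambda>j. I (j\<^sup>2) / real (j\<^sup>2) - ln (real (j\<^sup>2))) \<longlonglongrightarrow> L"
  shows "(\<lambda>n. I n / real n - ln (real n)) \<longlonglongrightarrow> L"
proof -
  define y where "y j = I (j\<^sup>2) / real (j\<^sup>2) - ln (real (j\<^sup>2))" for j
  have y: "y \<longlonglongrightarrow> L"
    using lim by (simp add: y_def[abs_def])
  define s where "s n = floor_sqrt n" for n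
  have s: "(s n)\<^sup>2 \<le> n" "n < (Suc (s n))\<^sup>2" for n
    by (auto simp: s_def Suc_floor_sqrt_power2_gt)
  have s_top: "filterlim s at_top sequentially"
    unfolding filterlim_at_top eventually_sequentially
  proof (intro allI)
    fix Z
    show "\<exists>N. \<forall>n\<ge>N. Z \<le> s n"
      by (intro exI[of _ "Z\<^sup>2"]) (auto simp: s_def le_floor_sqrt_iff)
  qed
  have ev: "\<forall>\<^sub>F n in sequentially. 1 \<le> s n"
    using s_top by (simp add: filterlim_at_top)
  \<comment> \<open>The ratio of consecutive squares bounds the relative error of replacing
    \<open>n\<close> by either neighbouring square.\<close>
  define q where "q j = (real j + 1)\<^sup>2 / (real j)\<^sup>2" for j :: nat
  have q: "q \<longlonglongrightarrow> 1"
    unfolding q_def by real_asymp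
  have sq: "real ((s n)\<^sup>2) \<le> real n" "real n \<le> real ((Suc (s n))\<^sup>2)" for n
    using s[of n] by (simp_all only: of_nat_le_iff less_imp_le)
  let ?a = "\<lambda>n. real ((s n)\<^sup>2) / real n" and ?b = "\<lambda>n. real ((Suc (s n))\<^sup>2) / real n"
  have aux: "1 / (z / x) \<le> x / m \<and> x / m \<le> 1 \<and> 1 \<le> z / m \<and> z / m \<le> z / x \<and> ln x \<le> ln m \<and> ln m \<le> ln z"
    if "0 < x" "x \<le> m" "m \<le> z" for x m z :: real
    using that by (auto intro!: divide_left_mono)
  have bounds: "1 / q (s n) \<le> ?a n \<and> ?a n \<le> 1 \<and> 1 \<le> ?b n \<and> ?b n \<le> q (s n)
      \<and> ln (real ((s n)\<^sup>2)) \<le> ln (real n) \<and> ln (real n) \<le> ln (real ((Suc (s n))\<^sup>2))" if "1 \<le> s n" for n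
  proof -
    define j where "j = s n"
    have j: "j > 0"
      using that by (simp add: j_def)
    then have "0 < real (j\<^sup>2)"
      by simp
    then have n: "real n > 0"
      using sq(1)[of n] unfolding j_def by linarith
    have q': "q j = real ((Suc j)\<^sup>2) / real (j\<^sup>2)"
      by (simp add: q_def add.commute)
    show ?thesis
      unfolding j_def[symmetric] q'
      using aux[OF \<open>0 < real (j\<^sup>2)\<close> sq[of n, folded j_def]] .
  qed
  have a: "?a \<longlonglongrightarrow> 1"
  proof (rule tendsto_sandwich[OF _ _ _ tendsto_const])
    show "(\<lambda>n. 1 / q (s n)) \<longlonglongrightarrow> 1"
      using tendsto_divide[OF tendsto_const filterlim_compose[OF q s_top], of 1] by simp
  qed (use ev bounds in \<open>auto elim!: eventually_mono\<close>)
  have b: "?b \<longlonglongrightarrow> 1"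
  proof (rule tendsto_sandwich[OF _ _ tendsto_const filterlim_compose[OF q s_top]])
  qed (use ev bounds in \<open>auto elim!: eventually_mono\<close>)
  \<comment> \<open>The errors combine the change of the denominator, weighted by the logarithm, and
    the change of the logarithm. They vanish because \<open>q j - 1\<close> is of order
    \<open>1 / j\<close>, which beats \<open>ln (j\<^sup>2)\<close>.\<close>
  define r where "r j = (1 - 1 / q j) * ln (real (j\<^sup>2)) + (ln (real ((Suc j)\<^sup>2)) - ln (real (j\<^sup>2)))" for j
  define r' where "r' j = (q j - 1) * ln (real ((Suc j)\<^sup>2)) + (ln (real ((Suc j)\<^sup>2)) - ln (real (j\<^sup>2)))" for j
  have r: "r \<longlonglongrightarrow> 0" and r': "r' \<longlonglongrightarrow> 0"
    unfolding r_def r'_def q_def by real_asymp+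
  show ?thesis
  proof (rule tendsto_sandwich)
    show "(\<lambda>n. ?a n * y (s n) - r (s n)) \<longlonglongrightarrow> L"
      using tendsto_diff[OF tendsto_mult[OF a filterlim_compose[OF y s_top]] filterlim_compose[OF r s_top]] by simp
    show "(\<lambda>n. ?b n * y (Suc (s n)) + r' (s n)) \<longlonglongrightarrow> L"
      using tendsto_add[OF tendsto_mult[OF b filterlim_compose[OF y filterlim_compose[OF filterlim_Suc s_top]]]
          filterlim_compose[OF r' s_top]] by simp
    have I: "I (j\<^sup>2) / real n = real (j\<^sup>2) / real n * (y j + ln (real (j\<^sup>2)))" if "j \<ge> 1" for j n
      using that by (simp add: y_def)
    show "\<forall>\<^sub>F n in sequentially. ?a n * y (s n) - r (s n) \<le> I n / real n - ln (real n)"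
      using ev
    proof eventually_elim
      case (elim n)
      note bd = bounds[OF elim]
      have "I ((s n)\<^sup>2) / real n \<le> I n / real n"
        using monoD[OF mono s(1)] by (simp add: divide_right_mono)
      moreover have "(1 - ?a n) * ln (real ((s n)\<^sup>2)) \<le> (1 - 1 / q (s n)) * ln (real ((s n)\<^sup>2))"
        using bd elim by (intro mult_right_mono) auto
      moreover have "?a n * (y (s n) + ln (real ((s n)\<^sup>2))) = ?a n * y (s n) + ln (real ((s n)\<^sup>2)) - (1 - ?a n) * ln (real ((s n)\<^sup>2))"
        by (simp add: algebra_simps del: of_nat_power)
      moreover have "ln (real ((s n)\<^sup>2)) \<le> ln (real n)" "ln (real n) \<le> ln (real ((Suc (s n))\<^sup>2))"
        using bd by blast+
      ultimately show ?case
        using I[OF elim, of n] unfolding r_def by linarith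
    qed
    show "\<forall>\<^sub>F n in sequentially. I n / real n - ln (real n) \<le> ?b n * y (Suc (s n)) + r' (s n)"
      using ev
    proof eventually_elim
      case (elim n)
      note bd = bounds[OF elim]
      have "I n / real n \<le> I ((Suc (s n))\<^sup>2) / real n"
        using monoD[OF mono less_imp_le[OF s(2)]] by (simp add: divide_right_mono)
      moreover have "(?b n - 1) * ln (real ((Suc (s n))\<^sup>2)) \<le> (q (s n) - 1) * ln (real ((Suc (s n))\<^sup>2))"
        using bd elim by (intro mult_right_mono) auto
      moreover have "?b n * (y (Suc (s n)) + ln (real ((Suc (s n))\<^sup>2)))
          = ?b n * y (Suc (s n)) + ln (real ((Suc (s n))\<^sup>2)) + (?b n - 1) * ln (real ((Suc (s n))\<^sup>2))"
        by (simp add: algebra_simps del: of_nat_power)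
      moreover have "ln (real ((s n)\<^sup>2)) \<le> ln (real n)" "ln (real n) \<le> ln (real ((Suc (s n))\<^sup>2))"
        using bd by blast+
      ultimately show ?case
        using I[of "Suc (s n)" n] unfolding r'_def by linarith
    qed
  qed
qed

section \<open>Limit of the normalised path length\<close>

context hoppe_tree
begin

lemma norm_ipl_eq: "norm_ipl P n \<omega> = real (\<Sum>\<^sub># (D n \<omega>)) / real n - ln (real n)"
  by (cases "n = 0") (simp_all add: norm_ipl_def ipl_eq_sum_depths diff_divide_distrib)

lemma borel_measurable_norm_ipl [measurable]: "norm_ipl P n \<in> borel_measurable M"
proof -
  have "(\<lambda>\<omega>. norm_ipl P n \<omega>) \<in> borel_measurable M"
    unfolding norm_ipl_eq by (rule borel_measurable_D)
  then show ?thesis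
    by simp
qed

definition scale :: "nat \<Rightarrow> real" where
  "scale n = W n / real n"

definition shift :: "nat \<Rightarrow> real" where
  "shift n = hsum \<theta> n * scale n - ln (real n)"

text \<open>An affine function of the martingale with deterministic convergent coefficients, so
  limit statements transfer in both directions.\<close>

lemma norm_ipl_mart: "1 \<le> n \<Longrightarrow> norm_ipl P n \<omega> = mart \<theta> (D n \<omega>) * scale n + shift n"
proof -
  assume "1 \<le> n"
  have "(x / w - h) * (w / real n) + (h * (w / real n) - l) = x / real n - l" if "w > 0" for x w h l
    using that by (simp add: left_diff_distrib diff_divide_distrib)
  from this[OF W_pos[OF \<open>1 \<le> n\<close>]] show ?thesis
    by (simp only: norm_ipl_eq mart_def scale_def shift_def size_depths)
qed

lemma scale_tendsto: "scale \<longlonglongrightarrow> 1"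
  unfolding scale_def by real_asymp

lemma shift_convergent: "convergent shift"
proof -
  obtain c where c: "(\<lambda>n. hsum \<theta> n - ln (real n)) \<longlonglongrightarrow> c"
    using hsum_minus_ln_convergent[OF theta_pos] convergent_def by auto
  have "(\<lambda>n. (hsum \<theta> n - ln (real n)) * scale n + (scale n - 1) * ln (real n)) \<longlonglongrightarrow> c * 1 + 0"
  proof (intro tendsto_intros c scale_tendsto)
    \<comment> \<open>For positive \<open>n\<close> the factor \<open>scale n - 1\<close> is
      \<open>(\<theta> - 1) / n\<close>, which beats the logarithm.\<close>
    show "(\<lambda>n. (scale n - 1) * ln (real n)) \<longlonglongrightarrow> 0"
      unfolding scale_def by real_asymp
  qed
  moreover have "(\<lambda>n. (hsum \<theta> n - ln (real n)) * scale n + (scale n - 1) * ln (real n)) = shift"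
    by (auto simp: shift_def algebra_simps)
  ultimately show ?thesis
    by (metis convergentI)
qed

lemma msq_gap_le:
  assumes C: "C > 0" "\<And>n. 1 \<le> n \<Longrightarrow> msq (Suc n) - msq n \<le> C * real n powr (-7/4)" and n: "1 \<le> n"
  shows "msq (n + k) - msq n \<le> real k * (C * real n powr (-7/4))"
proof (induction k)
  case (Suc k)
  have "msq (Suc (n + k)) - msq (n + k) \<le> C * real (n + k) powr (-7/4)"
    using n by (intro C) simp
  also have "\<dots> \<le> C * real n powr (-7/4)"
    using C n by (intro mult_left_mono powr_mono2') auto
  finally show ?case
    using Suc by (simp add: algebra_simps)
qed simp

text \<open>A block between consecutive squares contains \<open>2 * j + 3\<close> increments of
  \<open>msq\<close>, each at most \<open>C\<close> times \<open>(j + 1) powr (-7/2)\<close>. The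
  square root of their sum has the summable order \<open>(j + 1) powr (-5/4)\<close>. Indexing by
  \<open>Suc j\<close> avoids the empty tree.\<close>

lemma AE_mart_squares_convergent: "AE \<omega> in M. convergent (\<lambda>j. mart \<theta> (D ((Suc j)\<^sup>2) \<omega>))"
proof (rule AE_convergent_if_summable_increments)
  obtain C where C: "C > 0" "\<And>n. 1 \<le> n \<Longrightarrow> msq (Suc n) - msq n \<le> C * real n powr (-7/4)"
    using msq_increment_bound by blast
  show "summable (\<lambda>j. expectation (\<lambda>\<omega>. \<bar>mart \<theta> (D ((Suc (Suc j))\<^sup>2) \<omega>) - mart \<theta> (D ((Suc j)\<^sup>2) \<omega>)\<bar>))"
  proof (rule summable_comparison_test')
    have "summable (\<lambda>j. real (Suc j) powr (-5/4))"
      by (subst summable_Suc_iff) (simp add: summable_real_powr_iff)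
    then show "summable (\<lambda>j. sqrt (3 * C) * real (Suc j) powr (-5/4))"
      by (rule summable_mult)
    fix j :: nat
    let ?d = "\<lambda>\<omega>. mart \<theta> (D ((Suc (Suc j))\<^sup>2) \<omega>) - mart \<theta> (D ((Suc j)\<^sup>2) \<omega>)"
    let ?x = "real (Suc j)"
    have n: "1 \<le> (Suc j)\<^sup>2" "(Suc j)\<^sup>2 \<le> (Suc (Suc j))\<^sup>2" "(Suc (Suc j))\<^sup>2 = (Suc j)\<^sup>2 + (2 * j + 3)"
      by (simp_all add: power2_eq_square)
    have "expectation (\<lambda>\<omega>. \<bar>?d \<omega>\<bar>) \<le> sqrt (expectation (\<lambda>\<omega>. (?d \<omega>)\<^sup>2))"
      using expectation_mart_diff_squared(1)[OF n(1,2)] by (intro expectation_abs_le_sqrt) measurable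
    also have "expectation (\<lambda>\<omega>. (?d \<omega>)\<^sup>2) = msq ((Suc j)\<^sup>2 + (2 * j + 3)) - msq ((Suc j)\<^sup>2)"
      using expectation_mart_diff_squared(2)[OF n(1,2)] n(3) by simp
    also have "\<dots> \<le> real (2 * j + 3) * (C * real ((Suc j)\<^sup>2) powr (-7/4))"
      using msq_gap_le[OF C n(1)] .
    also have "\<dots> \<le> (3 * ?x) * (C * real ((Suc j)\<^sup>2) powr (-7/4))"
      using C by (intro mult_right_mono) auto
    also have "real ((Suc j)\<^sup>2) powr (-7/4) = ?x powr (-7/2)"
      by (simp add: powr_powr flip: powr_realpow powr_numeral)
    also have "(3 * ?x) * (C * ?x powr (-7/2)) = 3 * C * (?x powr 1 * ?x powr (-7/2))"
      by simp
    also have "?x powr 1 * ?x powr (-7/2) = ?x powr (-5/4) * ?x powr (-5/4)"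
      by (simp only: powr_add[symmetric]) simp
    also have "sqrt (3 * C * (?x powr (-5/4) * ?x powr (-5/4))) = sqrt (3 * C) * ?x powr (-5/4)"
      using C by (simp add: real_sqrt_mult)
    finally show "norm (expectation (\<lambda>\<omega>. \<bar>?d \<omega>\<bar>)) \<le> sqrt (3 * C) * ?x powr (-5/4)"
      by simp
  qed
qed (rule integrable_D)

text \<open>Defined at every point, which makes measurability immediate; the value where the
  sequence diverges is immaterial.\<close>

definition limit :: "'a \<Rightarrow> real" where
  "limit \<omega> = lim (\<lambda>n. norm_ipl P n \<omega>)"

lemma borel_measurable_limit [measurable]: "limit \<in> borel_measurable M"
  unfolding limit_def by measurable

lemma AE_limit: "AE \<omega> in M. (\<lambda>n. norm_ipl P n \<omega>) \<longlonglongrightarrow> limit \<omega>"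
  using AE_mart_squares_convergent
proof eventually_elim
  case (elim \<omega>)
  let ?s = "\<lambda>j. (Suc j)\<^sup>2"
  have s: "filterlim ?s at_top sequentially"
    by (rule filterlim_subseq) (auto simp: strict_mono_Suc_iff power2_eq_square)
  obtain c where c: "shift \<longlonglongrightarrow> c"
    using shift_convergent convergent_def by auto
  obtain L where L: "(\<lambda>j. mart \<theta> (D (?s j) \<omega>)) \<longlonglongrightarrow> L"
    using elim convergent_def by auto
  have "(\<lambda>j. mart \<theta> (D (?s j) \<omega>) * scale (?s j) + shift (?s j)) \<longlonglongrightarrow> L * 1 + c"
    by (intro tendsto_intros L filterlim_compose[OF scale_tendsto s] filterlim_compose[OF c s])
  moreover have "(\<lambda>j. mart \<theta> (D (?s j) \<omega>) * scale (?s j) + shift (?s j)) = (\<lambda>j. norm_ipl P (?s j) \<omega>)"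
    by (intro ext norm_ipl_mart[symmetric]) simp
  ultimately have "(\<lambda>j. norm_ipl P (?s j) \<omega>) \<longlonglongrightarrow> L + c"
    by simp
  then have "(\<lambda>j. norm_ipl P (j\<^sup>2) \<omega>) \<longlonglongrightarrow> L + c"
    using filterlim_sequentially_Suc[of "\<lambda>j. norm_ipl P (j\<^sup>2) \<omega>"] by simp
  then have "(\<lambda>n. norm_ipl P n \<omega>) \<longlonglongrightarrow> L + c"
    unfolding norm_ipl_eq
  proof (rule tendsto_from_squares[rotated])
    show "mono (\<lambda>n. real (\<Sum>\<^sub># (D n \<omega>)))"
      by (intro monoI) (auto simp flip: ipl_eq_sum_depths simp: ipl_def intro!: sum_mono2)
  qed
  then show ?case
    by (simp add: limit_def limI)
qed

definition shift_limit :: real where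
  "shift_limit = lim shift"

lemma shift_tendsto: "shift \<longlonglongrightarrow> shift_limit"
  using shift_convergent by (simp add: shift_limit_def convergent_LIMSEQ_iff)

definition mart_limit :: "'a \<Rightarrow> real" where
  "mart_limit \<omega> = limit \<omega> - shift_limit"

lemma borel_measurable_mart_limit [measurable]: "mart_limit \<in> borel_measurable M"
  unfolding mart_limit_def[abs_def] by measurable

lemma AE_mart_limit: "AE \<omega> in M. (\<lambda>m. mart \<theta> (D m \<omega>)) \<longlonglongrightarrow> mart_limit \<omega>"
  using AE_limit
proof eventually_elim
  case (elim \<omega>)
  have "(\<lambda>m. (norm_ipl P m \<omega> - shift m) / scale m) \<longlonglongrightarrow> (limit \<omega> - shift_limit) / 1"
    by (intro tendsto_intros elim shift_tendsto scale_tendsto) simp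
  moreover have "\<forall>\<^sub>F m in sequentially. (norm_ipl P m \<omega> - shift m) / scale m = mart \<theta> (D m \<omega>)"
    using eventually_ge_at_top[of 1]
  proof eventually_elim
    case (elim m)
    then have "scale m > 0"
      using W_pos[of m] by (simp add: scale_def)
    then show ?case
      using elim by (simp add: norm_ipl_mart)
  qed
  ultimately show ?case
    unfolding mart_limit_def by (simp add: tendsto_cong)
qed

text \<open>Fatou's lemma for the squared differences as the later index grows: by orthogonality
  their expectations are at most \<open>E - msq n\<close>, with \<open>E\<close> the limit of
  \<open>msq\<close>. This gives integrability and convergence at once.\<close>

lemma integrable_mart_limit_diff: "1 \<le> n \<Longrightarrow> integrable M (\<lambda>\<omega>. (mart_limit \<omega> - mart \<theta> (D n \<omega>))\<^sup>2)"
  and mart_L2_limit: "(\<lambda>n. expectation (\<lambda>\<omega>. (mart_limit \<omega> - mart \<theta> (D n \<omega>))\<^sup>2)) \<longlonglongrightarrow> 0"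
proof -
  note Z = AE_mart_limit
  obtain E where E: "msq \<longlonglongrightarrow> E"
    using msq_convergent convergent_def by auto
  have le_E: "msq n \<le> E" if "1 \<le> n" for n
    using E msq_mono that by (intro LIMSEQ_le_const) auto
  have nn: "(\<integral>\<^sup>+\<omega>. ennreal ((mart_limit \<omega> - mart \<theta> (D n \<omega>))\<^sup>2) \<partial>M) \<le> ennreal (E - msq n)" if n: "1 \<le> n" for n
  proof -
    let ?f = "\<lambda>m \<omega>. ennreal ((mart \<theta> (D m \<omega>) - mart \<theta> (D n \<omega>))\<^sup>2)"
    have "(\<integral>\<^sup>+\<omega>. ennreal ((mart_limit \<omega> - mart \<theta> (D n \<omega>))\<^sup>2) \<partial>M) = (\<integral>\<^sup>+\<omega>. liminf (\<lambda>m. ?f m \<omega>) \<partial>M)"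
    proof (rule nn_integral_cong_AE)
      show "AE \<omega> in M. ennreal ((mart_limit \<omega> - mart \<theta> (D n \<omega>))\<^sup>2) = liminf (\<lambda>m. ?f m \<omega>)"
        using Z
      proof eventually_elim
        case (elim \<omega>)
        then have "(\<lambda>m. ?f m \<omega>) \<longlonglongrightarrow> ennreal ((mart_limit \<omega> - mart \<theta> (D n \<omega>))\<^sup>2)"
          by (intro tendsto_ennrealI tendsto_intros)
        then show ?case
          by (rule lim_imp_Liminf[symmetric, rotated]) simp
      qed
    qed
    also have "\<dots> \<le> liminf (\<lambda>m. \<integral>\<^sup>+\<omega>. ?f m \<omega> \<partial>M)"
      by (intro nn_integral_liminf) measurable
    also have "\<dots> \<le> ennreal (E - msq n)"
    proof (rule Liminf_le)
      show "\<forall>\<^sub>F m in sequentially. (\<integral>\<^sup>+\<omega>. ?f m \<omega> \<partial>M) \<le> ennreal (E - msq n)"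
        using eventually_ge_at_top[of n]
      proof eventually_elim
        case (elim m)
        have "(\<integral>\<^sup>+\<omega>. ?f m \<omega> \<partial>M) = ennreal (msq m - msq n)"
          using expectation_mart_diff_squared[OF n elim] by (subst nn_integral_eq_integral) auto
        then show ?case
          using le_E[of m] n elim by (simp add: ennreal_leI)
      qed
    qed simp
    finally show ?thesis .
  qed
  show int: "integrable M (\<lambda>\<omega>. (mart_limit \<omega> - mart \<theta> (D n \<omega>))\<^sup>2)" if "1 \<le> n" for n
  proof (rule integrableI_bounded)
    have "(\<integral>\<^sup>+\<omega>. ennreal (norm ((mart_limit \<omega> - mart \<theta> (D n \<omega>))\<^sup>2)) \<partial>M) \<le> ennreal (E - msq n)"
      using nn[OF that] by simp
    then show "(\<integral>\<^sup>+\<omega>. ennreal (norm ((mart_limit \<omega> - mart \<theta> (D n \<omega>))\<^sup>2)) \<partial>M) < \<infinity>"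
      by (rule le_less_trans) simp
  qed measurable
  have exp_le: "expectation (\<lambda>\<omega>. (mart_limit \<omega> - mart \<theta> (D n \<omega>))\<^sup>2) \<le> E - msq n" if "1 \<le> n" for n
  proof -
    have "ennreal (expectation (\<lambda>\<omega>. (mart_limit \<omega> - mart \<theta> (D n \<omega>))\<^sup>2)) \<le> ennreal (E - msq n)"
      using nn[OF that] int[OF that] by (subst nn_integral_eq_integral[symmetric]) auto
    then show ?thesis
      using le_E[OF that] by (simp add: ennreal_le_iff)
  qed
  show "(\<lambda>n. expectation (\<lambda>\<omega>. (mart_limit \<omega> - mart \<theta> (D n \<omega>))\<^sup>2)) \<longlonglongrightarrow> 0"
  proof (rule tendsto_sandwich[OF _ _ tendsto_const])
    show "(\<lambda>n. E - msq n) \<longlonglongrightarrow> 0"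
      using tendsto_diff[OF tendsto_const E, of E] by simp
  qed (use exp_le in \<open>auto intro: eventually_sequentiallyI[of 1]\<close>)
qed

lemma integrable_mart_limit_squared: "integrable M (\<lambda>\<omega>. (mart_limit \<omega>)\<^sup>2)"
  \<comment> \<open>For a single node \<open>mart\<close> is 0, so the difference with index 1 is
    the limit itself.\<close>
  using integrable_mart_limit_diff[of 1] by (simp add: mart_def)

lemma integrable_limit_squared: "integrable M (\<lambda>\<omega>. (limit \<omega>)\<^sup>2)"
proof -
  have "integrable M mart_limit"
    using square_integrable_imp_integrable integrable_mart_limit_squared borel_measurable_mart_limit by blast
  moreover have "limit \<omega> = mart_limit \<omega> + shift_limit" for \<omega>
    by (simp add: mart_limit_def)
  ultimately show ?thesis
    using integrable_mart_limit_squared by (auto simp: power2_sum)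
qed

lemma integrable_limit: "integrable M limit"
  using square_integrable_imp_integrable integrable_limit_squared borel_measurable_limit by blast

text \<open>The error splits into those of the martingale, of \<open>scale\<close> and of
  \<open>shift\<close>; the last two are deterministic.\<close>

lemma L2_limit: "(\<lambda>n. expectation (\<lambda>\<omega>. (norm_ipl P n \<omega> - limit \<omega>)\<^sup>2)) \<longlonglongrightarrow> 0"
proof -
  note Z2 = integrable_mart_limit_squared integrable_mart_limit_diff
  let ?B = "\<lambda>n \<omega>. 3 * ((scale n)\<^sup>2 * (mart_limit \<omega> - mart \<theta> (D n \<omega>))\<^sup>2 + (scale n - 1)\<^sup>2 * (mart_limit \<omega>)\<^sup>2 + (shift n - shift_limit)\<^sup>2)"
  have bound: "(norm_ipl P n \<omega> - limit \<omega>)\<^sup>2 \<le> ?B n \<omega>" if "1 \<le> n" for n \<omega>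
  proof -
    have sq: "(x + y + z)\<^sup>2 \<le> 3 * (x\<^sup>2 + y\<^sup>2 + z\<^sup>2)" for x y z :: real
    proof -
      have "3 * (x\<^sup>2 + y\<^sup>2 + z\<^sup>2) - (x + y + z)\<^sup>2 = (x - y)\<^sup>2 + (y - z)\<^sup>2 + (x - z)\<^sup>2"
        by (simp add: power2_eq_square algebra_simps)
      also have "\<dots> \<ge> 0"
        by simp
      finally show ?thesis
        by simp
    qed
    have "norm_ipl P n \<omega> - limit \<omega> = scale n * - (mart_limit \<omega> - mart \<theta> (D n \<omega>)) + (scale n - 1) * mart_limit \<omega> + (shift n - shift_limit)"
      using that by (simp add: norm_ipl_mart mart_limit_def algebra_simps)
    then show ?thesis
      using sq[of "scale n * - (mart_limit \<omega> - mart \<theta> (D n \<omega>))" "(scale n - 1) * mart_limit \<omega>" "shift n - shift_limit"]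
      by (simp only: power_mult_distrib power2_minus)
  qed
  show ?thesis
  proof (rule tendsto_sandwich[OF _ _ tendsto_const])
    let ?U = "\<lambda>n. 3 * ((scale n)\<^sup>2 * expectation (\<lambda>\<omega>. (mart_limit \<omega> - mart \<theta> (D n \<omega>))\<^sup>2)
      + (scale n - 1)\<^sup>2 * expectation (\<lambda>\<omega>. (mart_limit \<omega>)\<^sup>2) + (shift n - shift_limit)\<^sup>2)"
    have "?U \<longlonglongrightarrow> 3 * (1\<^sup>2 * 0 + (1 - 1)\<^sup>2 * expectation (\<lambda>\<omega>. (mart_limit \<omega>)\<^sup>2) + (shift_limit - shift_limit)\<^sup>2)"
      by (intro tendsto_intros shift_tendsto mart_L2_limit scale_tendsto)
    then show "?U \<longlonglongrightarrow> 0"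
      by simp
    show "\<forall>\<^sub>F n in sequentially. expectation (\<lambda>\<omega>. (norm_ipl P n \<omega> - limit \<omega>)\<^sup>2) \<le> ?U n"
      using eventually_ge_at_top[of 1]
    proof eventually_elim
      case (elim n)
      have "expectation (\<lambda>\<omega>. (norm_ipl P n \<omega> - limit \<omega>)\<^sup>2) \<le> expectation (?B n)"
        using bound[OF elim] Z2(1) Z2(2)[OF elim]
        by (intro integral_mono_AE' AE_I2) (auto intro!: Bochner_Integration.integrable_add integrable_mult_right)
      also have "\<dots> = ?U n"
        using Z2(1) Z2(2)[OF elim] by (simp add: prob_space)
      finally show ?case .
    qed
  qed auto
qed

text \<open>If the limit were constant, the variances of the martingale would tend to 0, but they increase.\<close>

lemma limit_nondegenerate: "\<not> (\<exists>c. AE \<omega> in M. limit \<omega> = c)"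
proof
  assume "\<exists>c. AE \<omega> in M. limit \<omega> = c"
  then obtain x where x: "AE \<omega> in M. limit \<omega> = x"
    by blast
  have "\<forall>\<^sub>F n in sequentially. msq 3 \<le> expectation (\<lambda>\<omega>. (mart_limit \<omega> - mart \<theta> (D n \<omega>))\<^sup>2)"
    using eventually_ge_at_top[of 3]
  proof eventually_elim
    case (elim n)
    have int: "integrable M (\<lambda>\<omega>. (mart \<theta> (D n \<omega>))\<^sup>2)" "integrable M (\<lambda>\<omega>. mart \<theta> (D n \<omega>))"
      by (rule integrable_D)+
    have "expectation (\<lambda>\<omega>. (mart_limit \<omega> - mart \<theta> (D n \<omega>))\<^sup>2) = expectation (\<lambda>\<omega>. (x - shift_limit)\<^sup>2 + (mart \<theta> (D n \<omega>))\<^sup>2 - 2 * (x - shift_limit) * mart \<theta> (D n \<omega>))"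
    proof (rule integral_cong_AE)
      show "AE \<omega> in M. (mart_limit \<omega> - mart \<theta> (D n \<omega>))\<^sup>2 = (x - shift_limit)\<^sup>2 + (mart \<theta> (D n \<omega>))\<^sup>2 - 2 * (x - shift_limit) * mart \<theta> (D n \<omega>)"
        using x by eventually_elim (auto simp: mart_limit_def power2_diff)
    qed measurable
    \<comment> \<open>The cross term vanishes because the martingale has mean 0.\<close>
    also have "\<dots> = (x - shift_limit)\<^sup>2 + msq n"
      using int elim by (simp add: prob_space expectation_mart) (simp add: msq_def)
    finally show ?case
      using msq_pos[OF elim] by (smt (verit) zero_le_power2)
  qed
  then have "msq 3 \<le> 0"
    using tendsto_lowerbound[OF mart_L2_limit] by simp
  then show False
    using msq_pos[of 3] by simp
qed

end

section \<open>Splitting at node 1\<close>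

lemma sum_mset_linear: "linear h \<Longrightarrow> (\<Sum>d\<in>#B. h (f d)) = h (\<Sum>d\<in>#B. f d)"
  by (induction B) (simp_all add: linear_0 linear_add)

lemma grow_linear: "linear h \<Longrightarrow> grow \<theta> (\<lambda>A. h (F A)) A = h (grow \<theta> F A)"
  by (simp add: grow_def sum_mset_linear[of h] linear_add linear_scale)

lemma grow_funpow_linear: "linear h \<Longrightarrow> (grow \<theta> ^^ n) (\<lambda>A. h (F A)) A = h ((grow \<theta> ^^ n) F A)"
proof (induction n arbitrary: A)
  case (Suc n)
  then have "(grow \<theta> ^^ n) (\<lambda>A. h (F A)) = (\<lambda>A. h ((grow \<theta> ^^ n) F A))"
    by blast
  then show ?case
    using Suc.prems by (simp add: grow_linear)
qed simp

lemma grow_add: "grow \<theta> (\<lambda>A. F A + G A) A = grow \<theta> F A + grow \<theta> G A"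
  by (simp add: grow_def sum_mset.distrib scaleR_add_right)

lemma grow_funpow_add: "(grow \<theta> ^^ n) (\<lambda>A. F A + G A) A = (grow \<theta> ^^ n) F A + (grow \<theta> ^^ n) G A"
proof (induction n arbitrary: A)
  case (Suc n)
  then have "(grow \<theta> ^^ n) (\<lambda>A. F A + G A) = (\<lambda>A. (grow \<theta> ^^ n) F A + (grow \<theta> ^^ n) G A)"
    by blast
  then show ?case
    by (simp add: grow_add)
qed simp

lemma grow_scaleR: "grow \<theta> (\<lambda>A. c *\<^sub>R F A) A = c *\<^sub>R grow \<theta> F A"
  by (rule grow_linear[of "\<lambda>x. c *\<^sub>R x"]) simp

lemma grow_funpow_scaleR: "(grow \<theta> ^^ n) (\<lambda>A. c *\<^sub>R F A) A = c *\<^sub>R (grow \<theta> ^^ n) F A"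
  by (rule grow_funpow_linear[of "\<lambda>x. c *\<^sub>R x"]) simp

lemma grow_sum_mset: "grow \<theta> (\<lambda>A. \<Sum>d\<in>#B. F d A) A = (\<Sum>d\<in>#B. grow \<theta> (F d) A)"
proof (induction B)
  case empty
  show ?case
    by (simp add: grow_def)
qed (simp add: grow_add)

text \<open>\<open>grow\<close> is a finite linear combination of evaluations, so copies acting on
  different arguments can be interchanged. This expresses the independence of the two parts of the
  tree.\<close>

lemma grow_commute: "grow \<theta> (\<lambda>A. grow \<theta>' (\<lambda>B. G A B) B) A = grow \<theta>' (\<lambda>B. grow \<theta> (\<lambda>A. G A B) A) B"
  by (simp add: grow_def[of \<theta>'] grow_scaleR grow_add grow_sum_mset)

lemma grow_funpow_commute:
  "grow \<theta> (\<lambda>A. (grow \<theta>' ^^ n) (\<lambda>B. G A B) B) A = (grow \<theta>' ^^ n) (\<lambda>B. grow \<theta> (\<lambda>A. G A B) A) B"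
proof (induction n arbitrary: B)
  case (Suc n)
  then have "(\<lambda>B. grow \<theta> (\<lambda>A. (grow \<theta>' ^^ n) (G A) B) A) = (grow \<theta>' ^^ n) (\<lambda>B. grow \<theta> (\<lambda>A. G A B) A)"
    by blast
  then show ?case
    by (simp add: grow_commute flip: Suc.IH)
qed simp

lemma grow_cong: "(\<And>B. size B = Suc (size A) \<Longrightarrow> F B = G B) \<Longrightarrow> grow \<theta> F A = grow \<theta> G A"
  by (simp add: grow_def)

text \<open>In the splitting lemma this turns the sizes, and hence the selection weights, into known
  constants.\<close>

lemma grow_funpow_cong:
  "(\<And>B. size B = size A + n \<Longrightarrow> F B = G B) \<Longrightarrow> (grow \<theta> ^^ n) F A = (grow \<theta> ^^ n) G A"
proof (induction n arbitrary: A)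
  case (Suc n)
  show ?case
    unfolding funpow.simps comp_def by (intro grow_cong Suc) simp
qed simp

text \<open>\<open>A\<close> stands for the depths outside the subtree of node 1, with the root, and
  \<open>B\<close> for the depths inside it measured from node 1. The first coefficient is the
  probability that the new node falls outside, where the rule with \<open>\<theta>\<close> applies;
  inside, all weights are 1, which is the rule with parameter 1.\<close>

lemma grow_union:
  assumes "\<theta> + real (size A) - 1 \<noteq> 0" "B \<noteq> {#}" "\<theta> + real (size A) + real (size B) - 1 \<noteq> 0"
  shows "grow \<theta> F (A + image_mset Suc B) =
    ((\<theta> + real (size A) - 1) / (\<theta> + real (size A) + real (size B) - 1)) *\<^sub>R grow \<theta> (\<lambda>A. F (A + image_mset Suc B)) A
    + (real (size B) / (\<theta> + real (size A) + real (size B) - 1)) *\<^sub>R grow 1 (\<lambda>B. F (A + image_mset Suc B)) B"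
proof -
  define w where "w = \<theta> + real (size A) - 1"
  define z where "z = \<theta> + real (size A) + real (size B) - 1"
  have nz: "w \<noteq> 0" "z \<noteq> 0" "real (size B) \<noteq> 0"
    using assms by (auto simp: w_def z_def)
  let ?X = "(\<theta> - 1) *\<^sub>R F (add_mset 1 (A + image_mset Suc B)) + (\<Sum>d\<in>#A. F (add_mset (Suc d) (A + image_mset Suc B)))"
  let ?Y = "\<Sum>d\<in>#B. F (add_mset (Suc (Suc d)) (A + image_mset Suc B))"
  have 1: "grow \<theta> F (A + image_mset Suc B) = (?X + ?Y) /\<^sub>R z"
    by (simp add: grow_def z_def image_mset.compositionality o_def add_ac)
  have 2: "grow \<theta> (\<lambda>A. F (A + image_mset Suc B)) A = ?X /\<^sub>R w"
    by (simp add: grow_def w_def)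
  have 3: "grow 1 (\<lambda>B. F (A + image_mset Suc B)) B = ?Y /\<^sub>R real (size B)"
    by (simp add: grow_def)
  show ?thesis
    unfolding 1 2 3 w_def[symmetric] z_def[symmetric] scaleR_scaleR
    by (simp only: scaleR_add_right times_divide_eq_left right_inverse[OF nz(1)] right_inverse[OF nz(3)] inverse_eq_divide[of z])
qed

text \<open>The coefficient of \<open>x ^ m\<close> in the power series of
  \<open>(1 - x) powr (- z)\<close>.\<close>

definition rising :: "real \<Rightarrow> nat \<Rightarrow> real" where
  "rising z m = pochhammer z m / fact m"

lemma rising_0 [simp]: "rising z 0 = 1"
  by (simp add: rising_def)

lemma rising_Suc: "rising z (Suc m) * (real m + 1) = rising z m * (z + real m)"
  by (simp add: rising_def pochhammer_Suc add_ac)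

lemma rising_pos: "z > 0 \<Longrightarrow> rising z m > 0"
  by (simp add: rising_def pochhammer_pos)

text \<open>Multiplying a generating function by \<open>1 / (1 - x)\<close> forms partial sums; here
  it raises \<open>z\<close> by 1.\<close>

lemma sum_rising: "(\<Sum>i\<le>m. rising z i) = rising (z + 1) m"
proof (induction m)
  case (Suc m)
  have 1: "rising z (Suc m) = rising (z + 1) m * z / (real m + 1)"
    by (simp add: rising_def pochhammer_rec add_ac mult_ac)
  have 2: "rising (z + 1) (Suc m) = rising (z + 1) m * (z + 1 + real m) / (real m + 1)"
    using rising_Suc[of "z + 1" m] by (simp add: field_simps)
  show ?case
    unfolding sum.atMost_Suc Suc.IH 1 2 by (simp add: divide_simps) (simp add: algebra_simps)
qed simp

text \<open>The probability that in a tree with \<^term>\<open>n + 2\<close> nodes the subtree of node 1 has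
  \<^term>\<open>j + 1\<close> nodes: the law of a Polya urn started with weights \<^term>\<open>\<theta>\<close> and 1.\<close>

definition split_prob :: "real \<Rightarrow> nat \<Rightarrow> nat \<Rightarrow> real" where
  "split_prob \<theta> n j = (if j \<le> n then rising \<theta> (n - j) / rising (\<theta> + 1) n else 0)"

lemma split_prob_nonneg: "\<theta> > 0 \<Longrightarrow> split_prob \<theta> n j \<ge> 0"
  by (auto simp: split_prob_def intro!: divide_nonneg_nonneg less_imp_le[OF rising_pos])

text \<open>One step of the urn, of total weight \<open>\<theta> + n + 1\<close>: at index
  \<open>j\<close> the outside has weight \<open>\<theta> + n - j\<close>, and at index
  \<open>j - 1\<close> the subtree has \<open>j\<close> nodes of weight 1.\<close>

lemma split_prob_Suc:
  assumes th: "\<theta> > 0" and j: "j \<le> Suc n"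
  shows "split_prob \<theta> (Suc n) j = (\<theta> + real n - real j) / (\<theta> + real n + 1) * split_prob \<theta> n j
    + (if j = 0 then 0 else real j / (\<theta> + real n + 1) * split_prob \<theta> n (j - 1))"
proof -
  have R: "rising (\<theta> + 1) n > 0"
    using th by (intro rising_pos) simp
  have Rs: "rising (\<theta> + 1) (Suc n) = rising (\<theta> + 1) n * (\<theta> + real n + 1) / (real n + 1)"
    using rising_Suc[of "\<theta> + 1" n] by (simp add: field_simps)
  show ?thesis
  proof (cases "j \<le> n")
    case True
    then obtain i where i: "n = i + j"
      using le_Suc_ex by (metis add.commute)
    have *: "rising \<theta> (Suc i) * (real i + 1) = rising \<theta> i * (\<theta> + real i)"
      by (rule rising_Suc)
    have "split_prob \<theta> (Suc n) j = rising \<theta> (Suc i) * (real n + 1) / (rising (\<theta> + 1) n * (\<theta> + real n + 1))"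
      using Rs R th by (simp add: split_prob_def i Suc_diff_le)
    \<comment> \<open>The factor \<open>n + 1\<close> is split as \<open>(i + 1) + j\<close>, and
      the recursion for \<open>rising\<close> rewrites the first part.\<close>
    also have "\<dots> = rising \<theta> i * (\<theta> + real i) / (rising (\<theta> + 1) n * (\<theta> + real n + 1))
        + rising \<theta> (Suc i) * real j / (rising (\<theta> + 1) n * (\<theta> + real n + 1))"
      unfolding *[symmetric] by (simp add: i add_divide_distrib[symmetric] algebra_simps)
    also have "rising \<theta> i * (\<theta> + real i) / (rising (\<theta> + 1) n * (\<theta> + real n + 1))
        = (\<theta> + real n - real j) / (\<theta> + real n + 1) * split_prob \<theta> n j"
      by (simp add: split_prob_def i mult_ac)
    also have "rising \<theta> (Suc i) * real j / (rising (\<theta> + 1) n * (\<theta> + real n + 1))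
        = (if j = 0 then 0 else real j / (\<theta> + real n + 1) * split_prob \<theta> n (j - 1))"
      by (auto simp: split_prob_def i mult_ac Suc_diff_le gr0_conv_Suc)
    finally show ?thesis .
  next
    \<comment> \<open>Here the coefficient of \<open>split_prob \<theta> n j\<close> is
      \<open>\<theta> - 1\<close>, possibly nonzero; the term vanishes by the default 0 in
      \<open>split_prob\<close>.\<close>
    case False
    then have "j = Suc n"
      using j by simp
    then show ?thesis
      using Rs R th by (simp add: split_prob_def add_ac)
  qed
qed

text \<open>Given its size, the subtree of node 1 is a random recursive tree and the rest is a Hoppe tree,
  independently of each other.\<close>

lemma grow_split:
  assumes th: "\<theta> > 0"
  shows "(grow \<theta> ^^ n) F {#0, 1#} = (\<Sum>j\<le>n. split_prob \<theta> n j *\<^sub>R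
    (grow \<theta> ^^ (n - j)) (\<lambda>A. (grow 1 ^^ j) (\<lambda>B. F (A + image_mset Suc B)) {#0#}) {#0#})"
proof (induction n arbitrary: F)
  case 0
  show ?case
    by (simp add: split_prob_def add_mset_commute)
next
  case (Suc n)
  define U where "U i j = (grow \<theta> ^^ i) (\<lambda>A. (grow 1 ^^ j) (\<lambda>B. F (A + image_mset Suc B)) {#0#}) {#0#}" for i j
  let ?w = "\<theta> + real n + 1"
  \<comment> \<open>The last insertion, with the sizes of both parts fixed:
    \<open>grow_union\<close> makes it a mixture of one more insertion outside and one more
    inside.\<close>
  have step: "(grow \<theta> ^^ (n - j)) (\<lambda>A. (grow 1 ^^ j) (\<lambda>B. grow \<theta> F (A + image_mset Suc B)) {#0#}) {#0#}
      = ((\<theta> + real n - real j) / ?w) *\<^sub>R U (Suc n - j) j + (real (Suc j) / ?w) *\<^sub>R U (n - j) (Suc j)" if "j \<le> n" for j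
  proof -
    let ?a = "(\<theta> + real n - real j) / ?w" and ?b = "real (Suc j) / ?w"
    have "(grow \<theta> ^^ (n - j)) (\<lambda>A. (grow 1 ^^ j) (\<lambda>B. grow \<theta> F (A + image_mset Suc B)) {#0#}) {#0#}
      = (grow \<theta> ^^ (n - j)) (\<lambda>A. (grow 1 ^^ j) (\<lambda>B. ?a *\<^sub>R grow \<theta> (\<lambda>A. F (A + image_mset Suc B)) A
          + ?b *\<^sub>R grow 1 (\<lambda>B. F (A + image_mset Suc B)) B) {#0#}) {#0#}"
    proof (intro grow_funpow_cong)
      fix A B :: "nat multiset"
      assume "size A = size {#0::nat#} + (n - j)" "size B = size {#0::nat#} + j"
      then have A: "real (size A) = real n - real j + 1" and B: "real (size B) = real j + 1"
        using that by (simp_all add: of_nat_diff)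
      have "B \<noteq> {#}"
        using \<open>size B = _\<close> by auto
      show "grow \<theta> F (A + image_mset Suc B) = ?a *\<^sub>R grow \<theta> (\<lambda>A. F (A + image_mset Suc B)) A
          + ?b *\<^sub>R grow 1 (\<lambda>B. F (A + image_mset Suc B)) B"
        using grow_union[of \<theta> A B F] \<open>B \<noteq> {#}\<close> that th unfolding A B by (simp add: algebra_simps)
    qed
    also have "\<dots> = ?a *\<^sub>R (grow \<theta> ^^ Suc (n - j)) (\<lambda>A. (grow 1 ^^ j) (\<lambda>B. F (A + image_mset Suc B)) {#0#}) {#0#}
        + ?b *\<^sub>R (grow \<theta> ^^ (n - j)) (\<lambda>A. (grow 1 ^^ Suc j) (\<lambda>B. F (A + image_mset Suc B)) {#0#}) {#0#}"
      \<comment> \<open>The outside insertion is commuted past the inner iterate, so that it counts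
        towards the outer one.\<close>
      unfolding grow_funpow_add grow_funpow_scaleR grow_funpow_commute[symmetric] funpow_Suc_right comp_def ..
    finally show ?thesis
      using that by (simp add: U_def Suc_diff_le)
  qed
  have "(grow \<theta> ^^ Suc n) F {#0, 1#} = (grow \<theta> ^^ n) (grow \<theta> F) {#0, 1#}"
    by (simp add: funpow_swap1)
  also have "\<dots> = (\<Sum>j\<le>n. split_prob \<theta> n j *\<^sub>R (((\<theta> + real n - real j) / ?w) *\<^sub>R U (Suc n - j) j + (real (Suc j) / ?w) *\<^sub>R U (n - j) (Suc j)))"
    unfolding Suc.IH by (intro sum.cong refl) (simp add: step)
  also have "\<dots> = (\<Sum>j\<le>n. ((\<theta> + real n - real j) / ?w * split_prob \<theta> n j) *\<^sub>R U (Suc n - j) j)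
      + (\<Sum>j\<le>n. (real (Suc j) / ?w * split_prob \<theta> n j) *\<^sub>R U (n - j) (Suc j))"
    by (simp add: scaleR_add_right sum.distrib mult.commute)
  \<comment> \<open>The added term is 0 by the default in \<open>split_prob\<close>; the other sum
    is shifted by one, so that both have the same range and \<open>split_prob_Suc\<close> applies
    termwise.\<close>
  also have "(\<Sum>j\<le>n. ((\<theta> + real n - real j) / ?w * split_prob \<theta> n j) *\<^sub>R U (Suc n - j) j)
      = (\<Sum>j\<le>Suc n. ((\<theta> + real n - real j) / ?w * split_prob \<theta> n j) *\<^sub>R U (Suc n - j) j)"
    unfolding sum.atMost_Suc by (simp add: split_prob_def[of _ n "Suc n"])
  also have "(\<Sum>j\<le>n. (real (Suc j) / ?w * split_prob \<theta> n j) *\<^sub>R U (n - j) (Suc j))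
      = (\<Sum>j\<le>Suc n. (if j = 0 then 0 else real j / ?w * split_prob \<theta> n (j - 1)) *\<^sub>R U (Suc n - j) j)"
    by (subst sum.atMost_Suc_shift) simp
  also have "(\<Sum>j\<le>Suc n. ((\<theta> + real n - real j) / ?w * split_prob \<theta> n j) *\<^sub>R U (Suc n - j) j)
      + (\<Sum>j\<le>Suc n. (if j = 0 then 0 else real j / ?w * split_prob \<theta> n (j - 1)) *\<^sub>R U (Suc n - j) j)
      = (\<Sum>j\<le>Suc n. split_prob \<theta> (Suc n) j *\<^sub>R U (Suc n - j) j)"
    unfolding sum.distrib[symmetric] scaleR_add_left[symmetric]
    by (intro sum.cong refl) (simp only: split_prob_Suc[OF th] atMost_iff)
  finally show ?case
    unfolding U_def .
qed

text \<open>The characteristic function of the normalised path length with \<open>Suc n\<close>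
  nodes (\<open>growth_char_eq\<close>), written without a probability space.\<close>

definition growth_char :: "real \<Rightarrow> nat \<Rightarrow> real \<Rightarrow> complex" where
  "growth_char \<theta> n t = (grow \<theta> ^^ n) (\<lambda>A. iexp (t * (real (\<Sum>\<^sub># A) / real (Suc n) - ln (real (Suc n))))) {#0#}"

text \<open>The entropy terms come from renormalising the two parts by their own sizes, the summand
  \<open>b\<close> from the extra level: each node of the subtree of node 1 is one level deeper in
  the whole tree.\<close>

definition toll :: "real \<Rightarrow> real" where
  "toll b = b * ln b + (1 - b) * ln (1 - b) + b"

lemma toll_measurable [measurable]: "toll \<in> borel_measurable borel"
  unfolding toll_def[abs_def] by measurable

text \<open>The path length is the sum of those of the two parts plus the subtree size. In
  normalised quantities this is affine, so the exponential factorises and the two iterates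
  separate.\<close>

lemma growth_char_split:
  assumes th: "\<theta> > 0"
  shows "growth_char \<theta> (Suc n) t = (\<Sum>j\<le>n. of_real (split_prob \<theta> n j) *
    (growth_char \<theta> (n - j) ((1 - (real j + 1) / (real n + 2)) * t) * growth_char 1 j ((real j + 1) / (real n + 2) * t)
      * iexp (t * toll ((real j + 1) / (real n + 2)))))"
proof -
  define G where "G n t A = iexp (t * (real (\<Sum>\<^sub># A) / real (Suc n) - ln (real (Suc n))))" for n t and A :: "nat multiset"
  have *: "(grow \<theta> ^^ (n - j)) (\<lambda>A. (grow 1 ^^ j) (\<lambda>B. G (Suc n) t (A + image_mset Suc B)) {#0#}) {#0#}
    = growth_char \<theta> (n - j) ((1 - (real j + 1) / (real n + 2)) * t) * growth_char 1 j ((real j + 1) / (real n + 2) * t)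
      * iexp (t * toll ((real j + 1) / (real n + 2)))" (is "?L = ?R") if j: "j \<le> n" for j
  proof -
    define b where "b = (real j + 1) / (real n + 2)"
    have "?L = (grow \<theta> ^^ (n - j)) (\<lambda>A. (grow 1 ^^ j) (\<lambda>B. (iexp (t * toll b) * G (n - j) ((1 - b) * t) A) * G j (b * t) B) {#0#}) {#0#}"
    proof (intro grow_funpow_cong)
      fix A B :: "nat multiset"
      assume "size A = size {#0::nat#} + (n - j)" "size B = size {#0::nat#} + j"
      define a where "a = real (Suc (n - j))"
      define k where "k = real j + 1"
      define N where "N = real n + 2"
      have pos: "a > 0" "k > 0" "N > 0" and N: "N = a + k"
        using j by (simp_all add: a_def k_def N_def of_nat_diff)
      have b: "b = k / N" "1 - b = a / N"
        using pos by (simp_all add: b_def k_def N_def[symmetric] N field_simps)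
      have size: "real (size B) = k"
        using \<open>size B = _\<close> by (simp add: k_def)
      define x where "x = real (\<Sum>\<^sub># A)"
      define y where "y = real (\<Sum>\<^sub># B)"
      have sum: "real (\<Sum>\<^sub># (A + image_mset Suc B)) = x + y + k"
      proof -
        have "(\<Sum>d\<in>#B. Suc d) = \<Sum>\<^sub># B + size B"
          by (induction B) auto
        then show ?thesis
          by (simp add: x_def y_def size)
      qed
      have "toll b = b * (ln k - ln N) + (1 - b) * (ln a - ln N) + b"
        using pos ln_div[of a N] ln_div[of k N] unfolding toll_def b(2) by (simp add: b(1))
      then have eq: "(x + y + k) / N - ln N = toll b + (1 - b) * (x / a - ln a) + b * (y / k - ln k)"
      proof -
        assume tb: "toll b = b * (ln k - ln N) + (1 - b) * (ln a - ln N) + b"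
        have "(1 - b) * (x / a) = x / N" "b * (y / k) = y / N" "b = k / N"
          unfolding b(2) using pos by (simp_all add: b(1))
        then have "(x + y + k) / N = (1 - b) * (x / a) + b * (y / k) + b"
          by (simp add: add_divide_distrib)
        then show ?thesis
          unfolding tb by (simp add: algebra_simps)
      qed
      have "t * ((x + y + k) / N - ln N) = t * toll b + ((1 - b) * t) * (x / a - ln a) + (b * t) * (y / k - ln k)"
        unfolding eq by (simp add: distrib_left mult_ac)
      moreover have "real (Suc (Suc n)) = N" "real (Suc j) = k"
        by (simp_all add: N_def k_def)
      ultimately show "G (Suc n) t (A + image_mset Suc B) = iexp (t * toll b) * G (n - j) ((1 - b) * t) A * G j (b * t) B"
        unfolding G_def sum a_def[symmetric] x_def[symmetric] y_def[symmetric]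
        by (simp add: exp_add[symmetric] distrib_left[symmetric] del: of_real_mult of_real_diff of_real_divide flip: of_real_add)
    qed
    also have "\<dots> = (grow \<theta> ^^ (n - j)) (\<lambda>A. (iexp (t * toll b) * growth_char 1 j (b * t)) * G (n - j) ((1 - b) * t) A) {#0#}"
      unfolding growth_char_def G_def
      by (subst grow_funpow_linear[of "\<lambda>x. (_ :: complex) * x"]) (auto simp: linear_times mult_ac)
    also have "\<dots> = (iexp (t * toll b) * growth_char 1 j (b * t)) * growth_char \<theta> (n - j) ((1 - b) * t)"
      unfolding growth_char_def G_def
      by (subst grow_funpow_linear[of "\<lambda>x. (_ :: complex) * x"]) (auto simp: linear_times mult_ac)
    finally show ?thesis
      unfolding b_def by (simp only: mult_ac)
  qed
  have "growth_char \<theta> (Suc n) t = grow \<theta> ((grow \<theta> ^^ n) (G (Suc n) t)) {#0#}"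
    unfolding growth_char_def G_def[abs_def] funpow.simps comp_def ..
  \<comment> \<open>The first insertion is forced: the weight \<open>\<theta>\<close> of the root is
    then the total weight.\<close>
  also have "\<dots> = (grow \<theta> ^^ n) (G (Suc n) t) {#0, 1#}"
    using th by (simp add: grow_def[where A = "{#0#}"] scaleR_left_diff_distrib add_mset_commute)
  also have "\<dots> = (\<Sum>j\<le>n. split_prob \<theta> n j *\<^sub>R
      (grow \<theta> ^^ (n - j)) (\<lambda>A. (grow 1 ^^ j) (\<lambda>B. G (Suc n) t (A + image_mset Suc B)) {#0#}) {#0#})"
    by (rule grow_split[OF th])
  finally show ?thesis
    by (simp add: * scaleR_conv_of_real)
qed

section \<open>The fixed point equation\<close>

lemma sets_beta1 [simp, measurable_cong]: "sets (beta1 \<theta>) = sets borel"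
  by (simp add: beta1_def)

lemma space_beta1 [simp]: "space (beta1 \<theta>) = UNIV"
  by (simp add: beta1_def)

lemma AE_beta1: "AE b in beta1 \<theta>. 0 < b \<and> b < 1"
proof -
  have "AE b in lborel. b \<noteq> (0::real) \<and> b \<noteq> 1"
    using AE_lborel_singleton[of "0::real"] AE_lborel_singleton[of "1::real"] by eventually_elim simp
  then have "AE b in lborel. 0 < ennreal (indicator {0..1} b * \<theta> * (1 - b) powr (\<theta> - 1)) \<longrightarrow> 0 < b \<and> b < 1"
    by eventually_elim (auto simp: indicator_def split: if_splits)
  then show ?thesis
    unfolding beta1_def by (subst AE_density) auto
qed

text \<open>Restricted to \<open>x < 1\<close> because for \<open>\<theta> < 1\<close> the density
  is unbounded near 1; the total mass is obtained afterwards as a limit.\<close>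

lemma emeasure_beta1_atMost:
  assumes "\<theta> > 0" "0 \<le> x" "x < 1"
  shows "emeasure (beta1 \<theta>) {..x} = ennreal (1 - (1 - x) powr \<theta>)"
proof -
  have "emeasure (beta1 \<theta>) {..x} = (\<integral>\<^sup>+b. ennreal (\<theta> * (1 - b) powr (\<theta> - 1)) * indicator {0..x} b \<partial>lborel)"
    unfolding beta1_def using assms
    by (subst emeasure_density) (auto intro!: nn_integral_cong split: split_indicator)
  also have "\<dots> = ennreal (- ((1 - x) powr \<theta>) - (- ((1 - 0) powr \<theta>)))"
  proof (rule nn_integral_FTC_Icc)
    fix b assume b: "b \<in> {0..x}"
    then show "((\<lambda>b. - ((1 - b) powr \<theta>)) has_real_derivative \<theta> * (1 - b) powr (\<theta> - 1)) (at b)"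
      using assms by (auto intro!: derivative_eq_intros)
  qed (use assms in auto)
  finally show ?thesis
    by simp
qed

lemma real_distribution_beta1:
  assumes th: "\<theta> > 0"
  shows "real_distribution (beta1 \<theta>)"
proof -
  define x where "x n = 1 - 1 / (real n + 1)" for n
  have x: "0 \<le> x n" "x n < 1" for n
    by (auto simp: x_def field_simps)
  have 1: "emeasure (beta1 \<theta>) (\<Union>n. {..x n}) = 1"
  proof (rule LIMSEQ_unique)
    show "(\<lambda>n. emeasure (beta1 \<theta>) {..x n}) \<longlonglongrightarrow> emeasure (beta1 \<theta>) (\<Union>n. {..x n})"
    proof (rule Lim_emeasure_incseq)
      have "incseq x"
        by (auto simp: incseq_def x_def field_simps)
      then show "incseq (\<lambda>n. {..x n})"
        by (auto simp: incseq_def intro: order_trans)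
    qed auto
    have "(\<lambda>n. 1 - (1 / (real n + 1)) powr \<theta>) \<longlonglongrightarrow> 1"
      using th by real_asymp
    then have "(\<lambda>n. ennreal (1 - (1 / (real n + 1)) powr \<theta>)) \<longlonglongrightarrow> ennreal 1"
      by (rule tendsto_ennrealI)
    then show "(\<lambda>n. emeasure (beta1 \<theta>) {..x n}) \<longlonglongrightarrow> 1"
      using x by (simp add: emeasure_beta1_atMost[OF th]) (simp add: x_def)
  qed
  have 2: "emeasure (beta1 \<theta>) (\<Union>n. {..x n}) = emeasure (beta1 \<theta>) (space (beta1 \<theta>))"
  proof (rule emeasure_eq_AE)
    show "AE b in beta1 \<theta>. b \<in> (\<Union>n. {..x n}) \<longleftrightarrow> b \<in> space (beta1 \<theta>)"
      using AE_beta1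
    proof eventually_elim
      case (elim b)
      then obtain n where "1 / (real n + 1) < 1 - b"
        using reals_Archimedean[of "1 - b"] by (auto simp: inverse_eq_divide add.commute)
      then have "b \<le> x n"
        unfolding x_def by linarith
      then show ?case
        by auto
    qed
  qed auto
  show ?thesis
    unfolding real_distribution_def real_distribution_axioms_def
    by (intro conjI prob_spaceI) (simp_all only: 1 2[symmetric] sets_beta1)
qed

lemma cdf_beta1:
  assumes "\<theta> > 0"
  shows "cdf (beta1 \<theta>) x = (if x < 0 then 0 else if x < 1 then 1 - (1 - x) powr \<theta> else 1)"
proof -
  interpret real_distribution "beta1 \<theta>"
    by (rule real_distribution_beta1[OF assms])
  consider "x < 0" | "0 \<le> x" "x < 1" | "1 \<le> x"
    by linarith
  then show ?thesis
  proof cases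
    case 1
    have "prob {..x} = prob {}"
      using AE_beta1[of \<theta>] 1 by (intro finite_measure_eq_AE) (auto elim!: eventually_mono)
    then show ?thesis
      using 1 by (simp add: cdf_def)
  next
    case 2
    have "(1 - x) powr \<theta> \<le> 1"
      using 2 assms by (intro powr_le1) auto
    then show ?thesis
      using 2 emeasure_beta1_atMost[OF assms 2] by (simp add: cdf_def measure_def)
  next
    case 3
    have "AE b in beta1 \<theta>. b \<in> {..x} \<longleftrightarrow> b \<in> space (beta1 \<theta>)"
      using AE_beta1 by eventually_elim (use 3 in auto)
    then have "prob {..x} = prob (space (beta1 \<theta>))"
      by (intro finite_measure_eq_AE) auto
    then show ?thesis
      using 3 prob_space by (simp add: cdf_def)
  qed
qed

section \<open>Characteristic functions under the fixed point map, and uniqueness\<close>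

lemma fp_map_toll: "fp_map (y, z, b) = (1 - b) * y + b * z + toll b"
  by (simp add: fp_map_def toll_def)

lemma fp_map_measurable [measurable]: "fp_map \<in> borel_measurable (borel \<Otimes>\<^sub>M (borel \<Otimes>\<^sub>M borel))"
  unfolding fp_map_def by measurable

text \<open>For given \<open>b\<close> the map is affine in the independent \<open>y\<close> and
  \<open>z\<close>, so Fubini's theorem leaves a product of two characteristic functions under the
  integral over \<open>b\<close>.\<close>

lemma fixed_point_law:
  assumes "real_distribution \<mu>" "real_distribution \<nu>" "real_distribution \<beta>"
  defines "\<kappa> \<equiv> distr (\<mu> \<Otimes>\<^sub>M (\<nu> \<Otimes>\<^sub>M \<beta>)) borel fp_map"
  shows real_distribution_fp: "real_distribution \<kappa>"
    and char_fp: "char \<kappa> t = (\<integral>b. char \<mu> ((1 - b) * t) * char \<nu> (b * t) * iexp (t * toll b) \<partial>\<beta>)"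
proof -
  interpret \<mu>: real_distribution \<mu> by fact
  interpret \<nu>: real_distribution \<nu> by fact
  interpret \<beta>: real_distribution \<beta> by fact
  interpret \<nu>\<beta>: pair_prob_space \<nu> \<beta> ..
  interpret \<mu>\<nu>\<beta>: pair_prob_space \<mu> "\<nu> \<Otimes>\<^sub>M \<beta>" ..
  have fp [measurable]: "fp_map \<in> borel_measurable (\<mu> \<Otimes>\<^sub>M (\<nu> \<Otimes>\<^sub>M \<beta>))"
    by measurable
  show "real_distribution \<kappa>"
    unfolding \<kappa>_def by simp
  have "char \<kappa> t = (\<integral>w. iexp (t * fp_map w) \<partial>(\<mu> \<Otimes>\<^sub>M (\<nu> \<Otimes>\<^sub>M \<beta>)))"
    unfolding char_def \<kappa>_def by (subst integral_distr) auto
  also have "\<dots> = (\<integral>(y, w). iexp (t * fp_map (y, w)) \<partial>(\<mu> \<Otimes>\<^sub>M (\<nu> \<Otimes>\<^sub>M \<beta>)))"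
    by (simp add: case_prod_beta')
  also have "\<dots> = (\<integral>w. (\<integral>y. iexp (t * fp_map (y, w)) \<partial>\<mu>) \<partial>(\<nu> \<Otimes>\<^sub>M \<beta>))"
    by (rule \<mu>\<nu>\<beta>.integral_snd[symmetric]) (auto intro!: \<mu>\<nu>\<beta>.P.integrable_const_bound[where B = 1] simp: case_prod_beta')
  also have "\<dots> = (\<integral>(z, b). char \<mu> ((1 - b) * t) * (iexp (b * t * z) * iexp (t * toll b)) \<partial>(\<nu> \<Otimes>\<^sub>M \<beta>))"
  proof (intro Bochner_Integration.integral_cong refl, clarify)
    fix z b
    have "(\<integral>y. iexp (t * fp_map (y, z, b)) \<partial>\<mu>) = (\<integral>y. iexp ((1 - b) * t * y) * (iexp (b * t * z) * iexp (t * toll b)) \<partial>\<mu>)"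
      by (intro Bochner_Integration.integral_cong refl) (simp add: fp_map_toll exp_add[symmetric] algebra_simps)
    also have "\<dots> = char \<mu> ((1 - b) * t) * (iexp (b * t * z) * iexp (t * toll b))"
      unfolding char_def by simp
    finally show "(\<integral>y. iexp (t * fp_map (y, z, b)) \<partial>\<mu>) = char \<mu> ((1 - b) * t) * (iexp (b * t * z) * iexp (t * toll b))" .
  qed
  also have "\<dots> = (\<integral>b. (\<integral>z. char \<mu> ((1 - b) * t) * (iexp (b * t * z) * iexp (t * toll b)) \<partial>\<nu>) \<partial>\<beta>)"
    by (rule \<nu>\<beta>.integral_snd[symmetric])
      (auto intro!: \<nu>\<beta>.P.integrable_const_bound[where B = 1] simp: case_prod_beta' norm_mult \<mu>.cmod_char_le_1)
  also have "\<dots> = (\<integral>b. char \<mu> ((1 - b) * t) * char \<nu> (b * t) * iexp (t * toll b) \<partial>\<beta>)"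
    unfolding char_def[of \<nu>] by (intro Bochner_Integration.integral_cong refl) (simp add: mult_ac)
  finally show "char \<kappa> t = (\<integral>b. char \<mu> ((1 - b) * t) * char \<nu> (b * t) * iexp (t * toll b) \<partial>\<beta>)" .
qed

text \<open>The distance of the characteristic functions of two solutions at \<^term>\<open>t\<close> is at most its average
  over \<^term>\<open>(1 - b) * t\<close>. At a maximum over a compact interval this is impossible unless the maximum
  is 0, because \<^term>\<open>(1 - b) * t\<close> is close to 0 with positive probability.\<close>

lemma fp_solution_unique:
  assumes th: "\<theta> > 0" and \<nu>: "real_prob_law \<nu>"
    and 1: "real_prob_law \<mu>" "fp_solution \<theta> \<nu> \<mu>" and 2: "real_prob_law \<mu>'" "fp_solution \<theta> \<nu> \<mu>'"
  shows "\<mu> = \<mu>'"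
proof -
  have dist: "real_distribution m" if "real_prob_law m" for m
    using that by (simp add: real_prob_law_def real_distribution_def real_distribution_axioms_def)
  interpret \<mu>: real_distribution \<mu> using dist 1 by blast
  interpret \<mu>': real_distribution \<mu>' using dist 2 by blast
  interpret \<nu>: real_distribution \<nu> using dist \<nu> by blast
  interpret \<beta>: real_distribution "beta1 \<theta>" by (rule real_distribution_beta1[OF th])
  define d where "d t = norm (char \<mu> t - char \<mu>' t)" for t
  have d_cont: "isCont d t" for t
    unfolding d_def by (intro continuous_intros \<mu>.isCont_char \<mu>'.isCont_char)
  then have [measurable]: "d \<in> borel_measurable borel"
    by (intro borel_measurable_continuous_onI) (auto intro: continuous_at_imp_continuous_on)
  have d_le_2: "d t \<le> 2" for t
    unfolding d_def using norm_triangle_ineq4[of "char \<mu> t" "char \<mu>' t"] \<mu>.cmod_char_le_1[of t] \<mu>'.cmod_char_le_1[of t]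
    by linarith
  have d_nonneg: "d t \<ge> 0" for t
    by (simp add: d_def)
  have d_int: "integrable (beta1 \<theta>) (\<lambda>b. d ((1 - b) * t))" for t
    by (rule \<beta>.integrable_const_bound[where B = 2]) (auto simp: d_le_2 d_nonneg)
  \<comment> \<open>Both integrands share the factor
    \<open>char \<nu> (b * t) * iexp (t * toll b)\<close> of modulus at most 1; this is where the
    common \<open>\<nu>\<close> enters.\<close>
  have d_le: "d t \<le> (\<integral>b. d ((1 - b) * t) \<partial>beta1 \<theta>)" for t
  proof -
    let ?f = "\<lambda>m b. char m ((1 - b) * t) * char \<nu> (b * t) * iexp (t * toll b)"
    have int: "integrable (beta1 \<theta>) (?f \<mu>)" "integrable (beta1 \<theta>) (?f \<mu>')"
      by (rule \<beta>.integrable_const_bound[where B = 1];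
        simp add: norm_mult mult_le_one \<mu>.cmod_char_le_1 \<mu>'.cmod_char_le_1 \<nu>.cmod_char_le_1)+
    have "char \<mu> t = (\<integral>b. ?f \<mu> b \<partial>beta1 \<theta>)" "char \<mu>' t = (\<integral>b. ?f \<mu>' b \<partial>beta1 \<theta>)"
      using char_fp[OF \<mu>.real_distribution_axioms \<nu>.real_distribution_axioms \<beta>.real_distribution_axioms, of t]
        char_fp[OF \<mu>'.real_distribution_axioms \<nu>.real_distribution_axioms \<beta>.real_distribution_axioms, of t]
        1(2) 2(2) by (simp_all add: fp_solution_def)
    then have "d t = norm (\<integral>b. ?f \<mu> b - ?f \<mu>' b \<partial>beta1 \<theta>)"
      using int by (simp add: d_def)
    also have "\<dots> \<le> (\<integral>b. norm (?f \<mu> b - ?f \<mu>' b) \<partial>beta1 \<theta>)"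
      by (rule integral_norm_bound)
    also have "\<dots> \<le> (\<integral>b. d ((1 - b) * t) \<partial>beta1 \<theta>)"
    proof (rule integral_mono)
      show "integrable (beta1 \<theta>) (\<lambda>b. norm (?f \<mu> b - ?f \<mu>' b))"
        using int by (intro integrable_norm Bochner_Integration.integrable_diff)
      fix b
      have "?f \<mu> b - ?f \<mu>' b = (char \<mu> ((1 - b) * t) - char \<mu>' ((1 - b) * t)) * (char \<nu> (b * t) * iexp (t * toll b))"
        by (simp add: algebra_simps)
      then have "norm (?f \<mu> b - ?f \<mu>' b) = d ((1 - b) * t) * norm (char \<nu> (b * t))"
        by (simp add: d_def norm_mult)
      also have "\<dots> \<le> d ((1 - b) * t) * 1"
        by (intro mult_left_mono \<nu>.cmod_char_le_1 d_nonneg)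
      finally show "norm (?f \<mu> b - ?f \<mu>' b) \<le> d ((1 - b) * t)"
        by simp
    qed (rule d_int)
    finally show ?thesis .
  qed
  have "d T = 0" for T
  proof -
    define R where "R = \<bar>T\<bar> + 1"
    have R: "R > 0"
      by (simp add: R_def)
    obtain t where t: "t \<in> {-R..R}" and max: "\<And>s. s \<in> {-R..R} \<Longrightarrow> d s \<le> d t"
      using continuous_attains_sup[of "{-R..R}" d] continuous_at_imp_continuous_on[of "{-R..R}" d] d_cont R by auto
    have "d t = 0"
    proof (rule ccontr)
      assume "d t \<noteq> 0"
      then have pos: "d t > 0"
        using d_nonneg[of t] by simp
      have "d 0 = 0"
        by (simp add: d_def \<mu>.char_zero \<mu>'.char_zero)
      then have "(d \<longlongrightarrow> 0) (at 0)"
        using d_cont[of 0] by (simp add: isCont_def)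
      then have "\<forall>\<^sub>F s in at 0. d s < d t / 2"
        by (rule order_tendstoD) (use pos in simp)
      then obtain \<delta> where \<delta>: "\<delta> > 0" and small: "\<And>s. s \<noteq> 0 \<Longrightarrow> \<bar>s\<bar> < \<delta> \<Longrightarrow> d s < d t / 2"
        unfolding eventually_at by (auto simp: dist_norm)
      \<comment> \<open>Chosen so that \<open>x < b < 1\<close> forces \<open>(1 - b) * t\<close>
        into the \<open>\<delta>\<close>-neighbourhood of 0; the maximum with 0 keeps
        \<open>x\<close> in the nontrivial branch of \<open>cdf_beta1\<close>.\<close>
      define x where "x = max 0 (1 - \<delta> / R)"
      have x: "0 \<le> x" "x < 1"
        using \<delta> R by (auto simp: x_def)
      have bound: "d ((1 - b) * t) \<le> d t - d t / 2 * indicator {x<..} b" if b: "0 < b" "b < 1" for b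
      proof (cases "x < b")
        case True
        have "\<bar>(1 - b) * t\<bar> \<le> (1 - b) * R"
          using b t by (auto simp: abs_mult intro!: mult_left_mono)
        also have "\<dots> < (\<delta> / R) * R"
          using True R by (intro mult_strict_right_mono) (auto simp: x_def)
        finally have "\<bar>(1 - b) * t\<bar> < \<delta>"
          using R by simp
        \<comment> \<open>\<open>small\<close> comes from a punctured neighbourhood;
          \<open>t\<close> is not 0 because \<open>d t > 0\<close> while
          \<open>d 0 = 0\<close>.\<close>
        moreover have "(1 - b) * t \<noteq> 0"
          using b pos \<open>d 0 = 0\<close> by auto
        ultimately have "d ((1 - b) * t) < d t / 2"
          by (intro small)
        then show ?thesis
          using True by simp
      next
        case False
        have "\<bar>(1 - b) * t\<bar> \<le> 1 * R"
          unfolding abs_mult using b t by (intro mult_mono) auto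
        then have "(1 - b) * t \<in> {-R..R}"
          by auto
        then show ?thesis
          using False max by simp
      qed
      have prob: "measure (beta1 \<theta>) {x<..} > 0"
      proof -
        have "measure (beta1 \<theta>) {x<..} = 1 - cdf (beta1 \<theta>) x"
          using \<beta>.prob_compl[of "{..x}"] by (simp add: cdf_def Compl_eq_Diff_UNIV[symmetric])
        also have "\<dots> = (1 - x) powr \<theta>"
          using x by (simp add: cdf_beta1[OF th])
        finally show ?thesis
          using x by simp
      qed
      have AE_bound: "AE b in beta1 \<theta>. d ((1 - b) * t) \<le> d t - d t / 2 * indicator {x<..} b"
        using AE_beta1 by eventually_elim (use bound in blast)
      have "d t \<le> (\<integral>b. d ((1 - b) * t) \<partial>beta1 \<theta>)"
        by (rule d_le)
      also have "\<dots> \<le> (\<integral>b. d t - d t / 2 * indicator {x<..} b \<partial>beta1 \<theta>)"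
        by (intro integral_mono_AE d_int AE_bound) (auto intro!: Bochner_Integration.integrable_diff simp: less_top[symmetric])
      also have "\<dots> = d t - d t / 2 * measure (beta1 \<theta>) {x<..}"
        by (subst Bochner_Integration.integral_diff) (auto simp: \<beta>.prob_space[simplified] less_top[symmetric])
      also have "\<dots> < d t"
        using pos prob by simp
      finally show False
        by simp
    qed
    moreover have "d T \<le> d t"
      by (rule max) (auto simp: R_def)
    ultimately show ?thesis
      using d_nonneg[of T] by simp
  qed
  then have "char \<mu> = char \<mu>'"
    by (auto simp: d_def)
  then show ?thesis
    using Levy_uniqueness \<mu>.real_distribution_axioms \<mu>'.real_distribution_axioms by blast
qed

section \<open>Convergence of the characteristic functions and of the relative subtree size\<close>

context hoppe_tree
begin

lemma growth_char_eq: "growth_char \<theta> n t = expectation (\<lambda>\<omega>. iexp (t * norm_ipl P (Suc n) \<omega>))"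
  unfolding growth_char_def integral_D[symmetric] norm_ipl_eq ..

lemma norm_growth_char_le: "norm (growth_char \<theta> n t) \<le> 1"
proof -
  have "norm (growth_char \<theta> n t) \<le> expectation (\<lambda>\<omega>. norm (iexp (t * norm_ipl P (Suc n) \<omega>)))"
    unfolding growth_char_eq by (rule integral_norm_bound)
  then show ?thesis
    by (simp add: prob_space)
qed

text \<open>Index and argument vary together because in the recursion both the size of a part and
  its share of \<open>t\<close> depend on \<open>n\<close>. Almost sure convergence handles this by
  dominated convergence.\<close>

lemma growth_char_tendsto:
  assumes m: "filterlim m at_top sequentially" and s: "s \<longlonglongrightarrow> t"
  shows "(\<lambda>n. growth_char \<theta> (m n) (s n)) \<longlonglongrightarrow> char (distr M borel limit) t"
proof -
  have "char (distr M borel limit) t = expectation (\<lambda>\<omega>. iexp (t * limit \<omega>))"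
    unfolding char_def by (subst integral_distr) auto
  moreover have "(\<lambda>n. expectation (\<lambda>\<omega>. iexp (s n * norm_ipl P (Suc (m n)) \<omega>))) \<longlonglongrightarrow> expectation (\<lambda>\<omega>. iexp (t * limit \<omega>))"
  proof (rule integral_dominated_convergence[where w = "\<lambda>_. 1"])
    show "AE \<omega> in M. (\<lambda>n. iexp (s n * norm_ipl P (Suc (m n)) \<omega>)) \<longlonglongrightarrow> iexp (t * limit \<omega>)"
      using AE_limit
    proof eventually_elim
      case (elim \<omega>)
      then have "(\<lambda>n. norm_ipl P (Suc (m n)) \<omega>) \<longlonglongrightarrow> limit \<omega>"
        by (rule filterlim_compose[OF _ filterlim_compose[OF filterlim_Suc m]])
      then show ?case
        by (intro tendsto_intros s)
    qed
  qed auto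
  ultimately show ?thesis
    by (simp add: growth_char_eq)
qed

end

text \<open>The Gamma series in another form; the nonzero constant will cancel in a
  quotient.\<close>

lemma rising_asymp:
  assumes th: "\<theta> > 0"
  shows "(\<lambda>m. real m powr \<theta> / rising (\<theta> + 1) m) \<longlonglongrightarrow> \<theta> * Gamma \<theta>"
proof -
  have "\<forall>\<^sub>F m in sequentially. \<theta> * Gamma_series \<theta> m = real m powr \<theta> / rising (\<theta> + 1) m"
    using eventually_gt_at_top[of 0]
    by eventually_elim (use th in \<open>simp add: Gamma_series_def rising_def pochhammer_rec powr_def\<close>)
  moreover have "(\<lambda>m. \<theta> * Gamma_series \<theta> m) \<longlonglongrightarrow> \<theta> * Gamma \<theta>"
    by (intro tendsto_intros Gamma_series_LIMSEQ)
  ultimately show ?thesis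
    by (rule Lim_transform_eventually[rotated])
qed

text \<open>Telescoping: by \<open>sum_rising\<close>, for positive \<open>i\<close> the value
  \<open>rising \<theta> i\<close> is a difference of consecutive values of
  \<open>rising (\<theta> + 1)\<close>.\<close>

lemma sum_split_prob:
  assumes th: "\<theta> > 0"
  shows "k \<le> n \<Longrightarrow> (\<Sum>j<k. split_prob \<theta> n j) = 1 - rising (\<theta> + 1) (n - k) / rising (\<theta> + 1) n"
proof (induction k)
  case 0
  then show ?case
    using rising_pos[of "\<theta> + 1" n] th by simp
next
  case (Suc k)
  have "rising (\<theta> + 1) (Suc (n - Suc k)) = rising (\<theta> + 1) (n - Suc k) + rising \<theta> (Suc (n - Suc k))"
    by (simp flip: sum_rising)
  moreover have "Suc (n - Suc k) = n - k"
    using Suc by simp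
  ultimately have "rising (\<theta> + 1) (n - k) = rising (\<theta> + 1) (n - Suc k) + rising \<theta> (n - k)"
    by simp
  then show ?case
    using Suc by (simp add: split_prob_def add_divide_distrib)
qed

lemma sum_split_prob_1:
  assumes "\<theta> > 0"
  shows "(\<Sum>j\<le>n. split_prob \<theta> n j) = 1"
  using sum_split_prob[OF assms, of n n] by (simp add: lessThan_Suc_atMost[symmetric] split_prob_def)

definition split_pmf :: "real \<Rightarrow> nat \<Rightarrow> nat pmf" where
  "split_pmf \<theta> n = embed_pmf (split_prob \<theta> n)"

context
  fixes \<theta> :: real
  assumes th: "\<theta> > 0"
begin

lemma nn_integral_split_prob: "(\<integral>\<^sup>+j. ennreal (split_prob \<theta> n j) \<partial>count_space UNIV) = 1"
proof -
  have "(\<integral>\<^sup>+j. ennreal (split_prob \<theta> n j) \<partial>count_space UNIV) = (\<Sum>j\<le>n. ennreal (split_prob \<theta> n j))"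
    by (rule nn_integral_count_space') (auto simp: split_prob_def)
  also have "\<dots> = ennreal (\<Sum>j\<le>n. split_prob \<theta> n j)"
    by (rule sum_ennreal) (rule split_prob_nonneg[OF th])
  finally show ?thesis
    by (simp add: sum_split_prob_1[OF th])
qed

lemma pmf_split_pmf: "pmf (split_pmf \<theta> n) j = split_prob \<theta> n j"
  unfolding split_pmf_def by (rule pmf_embed_pmf[OF split_prob_nonneg[OF th] nn_integral_split_prob])

lemma set_split_pmf: "j \<in> set_pmf (split_pmf \<theta> n) \<Longrightarrow> j \<le> n"
  by (auto simp: set_pmf_iff pmf_split_pmf split_prob_def split: if_splits)

lemma real_distribution_split: "real_distribution (distr (measure_pmf (split_pmf \<theta> n)) borel f)"
  by (rule prob_space.real_distribution_distr[OF measure_pmf.prob_space_axioms]) simp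

text \<open>By \<open>sum_split_prob\<close> the discrete distribution function is 1 minus a
  quotient of two \<open>rising\<close> values, and by \<open>rising_asymp\<close> this quotient
  behaves like \<open>((n - k) / n) powr \<theta>\<close> with \<open>k / n\<close> tending to
  \<open>x\<close>.\<close>

lemma weak_conv_split:
  "weak_conv_m (\<lambda>n. distr (measure_pmf (split_pmf \<theta> n)) borel (\<lambda>j. (real j + 1) / (real n + 2))) (beta1 \<theta>)"
  unfolding weak_conv_m_def weak_conv_def
proof (intro allI impI)
  fix x
  let ?F = "\<lambda>n. cdf (distr (measure_pmf (split_pmf \<theta> n)) borel (\<lambda>j. (real j + 1) / (real n + 2))) x"
  have F: "?F n = measure (measure_pmf (split_pmf \<theta> n)) {j. (real j + 1) / (real n + 2) \<le> x}" for n
    unfolding cdf_def by (subst measure_distr) (auto simp: vimage_def)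
  consider "x < 0" | "0 \<le> x" "x < 1" | "1 \<le> x"
    by linarith
  then show "?F \<longlonglongrightarrow> cdf (beta1 \<theta>) x"
  proof cases
    case 1
    then have "x < (real j + 1) / (real n + 2)" for j n
      by (intro less_le_trans[OF 1]) auto
    then have "{j. (real j + 1) / (real n + 2) \<le> x} = {}" for n
      by (auto simp: not_le)
    then show ?thesis
      using 1 by (simp add: F cdf_beta1[OF th])
  next
    case 3
    have "?F n = 1" for n
      unfolding F
    proof (rule measure_pmf.prob_eq_1[THEN iffD2])
      show "AE j in measure_pmf (split_pmf \<theta> n). j \<in> {j. (real j + 1) / (real n + 2) \<le> x}"
      proof (rule AE_pmfI)
        fix j assume "j \<in> set_pmf (split_pmf \<theta> n)"
        then have "(real j + 1) / (real n + 2) \<le> 1"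
          using set_split_pmf by fastforce
        then show "j \<in> {j. (real j + 1) / (real n + 2) \<le> x}"
          using order_trans[OF _ 3] by blast
      qed
    qed simp
    then show ?thesis
      using 3 by (simp add: cdf_beta1[OF th])
  next
    case 2
    \<comment> \<open>The condition \<open>(j + 1) / (n + 2) \<le> x\<close> is equivalent to
      \<open>j + 1 \<le> k n\<close>, that is, to \<open>j < k n\<close>.\<close>
    define k where "k n = nat \<lfloor>x * (real n + 2)\<rfloor>" for n
    have k: "real (k n) \<le> x * (real n + 2)" "x * (real n + 2) - 1 < real (k n)" for n
      using 2 by (auto simp: k_def of_nat_nat)
    have k_lim: "(\<lambda>n. real (k n) / real n) \<longlonglongrightarrow> x"
    proof (rule tendsto_sandwich)
      have "(\<lambda>n. x + (2 * x - 1) * (1 / real n)) \<longlonglongrightarrow> x + (2 * x - 1) * 0"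
        by (intro tendsto_intros lim_1_over_n)
      then show "(\<lambda>n. x + (2 * x - 1) * (1 / real n)) \<longlonglongrightarrow> x"
        by simp
      have "(\<lambda>n. x + (2 * x) * (1 / real n)) \<longlonglongrightarrow> x + (2 * x) * 0"
        by (intro tendsto_intros lim_1_over_n)
      then show "(\<lambda>n. x + (2 * x) * (1 / real n)) \<longlonglongrightarrow> x"
        by simp
      show "\<forall>\<^sub>F n in sequentially. x + (2 * x - 1) * (1 / real n) \<le> real (k n) / real n"
        using eventually_gt_at_top[of 0]
      proof eventually_elim
        case (elim n)
        then have "x + (2 * x - 1) * (1 / real n) = (x * (real n + 2) - 1) / real n"
          by (simp add: field_simps)
        also have "\<dots> \<le> real (k n) / real n"
          using k(2)[of n] by (intro divide_right_mono) auto
        finally show ?case .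
      qed
      show "\<forall>\<^sub>F n in sequentially. real (k n) / real n \<le> x + (2 * x) * (1 / real n)"
        using eventually_gt_at_top[of 0]
        by eventually_elim (use k(1) in \<open>simp add: field_simps\<close>)
    qed
    have ev: "\<forall>\<^sub>F n in sequentially. 0 < n \<and> k n < n"
      using order_tendstoD(2)[OF k_lim 2(2)] eventually_gt_at_top[of 0]
      by eventually_elim simp
    have m_lim: "(\<lambda>n. real (n - k n) / real n) \<longlonglongrightarrow> 1 - x"
    proof (rule Lim_transform_eventually)
      show "(\<lambda>n. 1 - real (k n) / real n) \<longlonglongrightarrow> 1 - x"
        by (intro tendsto_intros k_lim)
      show "\<forall>\<^sub>F n in sequentially. 1 - real (k n) / real n = real (n - k n) / real n"
        using ev by eventually_elim (simp add: of_nat_diff field_simps)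
    qed
    have "filterlim (\<lambda>n. real (n - k n) / real n * real n) at_top sequentially"
      by (rule filterlim_tendsto_pos_mult_at_top[OF m_lim _ filterlim_real_sequentially]) (use 2 in simp)
    then have "filterlim (\<lambda>n. real (n - k n)) at_top sequentially"
    proof (rule filterlim_mono_eventually[OF _ order_refl order_refl])
      show "\<forall>\<^sub>F n in sequentially. real (n - k n) / real n * real n = real (n - k n)"
        using eventually_gt_at_top[of 0] by eventually_elim simp
    qed
    then have m_top: "filterlim (\<lambda>n. n - k n) at_top sequentially"
      by (simp add: filterlim_sequentially_iff_filterlim_real)
    let ?a = "\<lambda>m. real m powr \<theta> / rising (\<theta> + 1) m"
    have c: "\<theta> * Gamma \<theta> \<noteq> 0"
      by (rule less_imp_neq[OF mult_pos_pos[OF th Gamma_real_pos[OF th]], symmetric])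
    have "(\<lambda>n. ?a n / ?a (n - k n) * (real (n - k n) / real n) powr \<theta>) \<longlonglongrightarrow> (\<theta> * Gamma \<theta>) / (\<theta> * Gamma \<theta>) * (1 - x) powr \<theta>"
      using 2 by (intro tendsto_intros rising_asymp[OF th] filterlim_compose[OF rising_asymp[OF th] m_top] m_lim c) auto
    then have lim: "(\<lambda>n. 1 - ?a n / ?a (n - k n) * (real (n - k n) / real n) powr \<theta>) \<longlonglongrightarrow> 1 - (1 - x) powr \<theta>"
      using c by (intro tendsto_intros) simp
    have "\<forall>\<^sub>F n in sequentially. 1 - ?a n / ?a (n - k n) * (real (n - k n) / real n) powr \<theta> = ?F n"
      using ev
    proof eventually_elim
      case (elim n)
      have "(real j + 1) / (real n + 2) \<le> x \<longleftrightarrow> j < k n" for j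
      proof -
        have "(real j + 1) / (real n + 2) \<le> x \<longleftrightarrow> real (Suc j) \<le> x * (real n + 2)"
          by (simp add: divide_le_eq add.commute)
        also have "\<dots> \<longleftrightarrow> Suc j \<le> k n"
          unfolding k_def using 2 by (subst le_nat_iff) (auto simp: le_floor_iff)
        finally show ?thesis
          by auto
      qed
      then have "?F n = (\<Sum>j<k n. split_prob \<theta> n j)"
        unfolding F by (simp add: measure_measure_pmf_finite pmf_split_pmf lessThan_def[symmetric])
      also have "\<dots> = 1 - rising (\<theta> + 1) (n - k n) / rising (\<theta> + 1) n"
        using elim by (intro sum_split_prob[OF th]) simp
      also have "rising (\<theta> + 1) (n - k n) / rising (\<theta> + 1) n = ?a n / ?a (n - k n) * (real (n - k n) / real n) powr \<theta>"
      proof -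
        have "real (n - k n) powr \<theta> > 0" "real n powr \<theta> > 0"
          using elim by simp_all
        then show ?thesis
          by (simp add: powr_divide)
      qed
      finally show ?case
        by simp
    qed
    from Lim_transform_eventually[OF lim this] show ?thesis
      using 2 by (simp add: cdf_beta1[OF th])
  qed
qed

end


text \<open>The recursion integrates functions that change with \<open>n\<close> and depend on the
  integer \<open>j\<close>, so weak convergence does not apply directly. The Skorohod representation
  makes the proportions converge pointwise; then each factor converges and dominated convergence
  applies.\<close>

lemma hoppe_fixed_point:
  assumes "hoppe_tree M P \<theta>" "hoppe_tree M1 Q 1"
  shows "fp_solution \<theta> (distr M1 borel (hoppe_tree.limit Q)) (distr M borel (hoppe_tree.limit P))"
proof -
  interpret T: hoppe_tree M P \<theta> by fact
  interpret R: hoppe_tree M1 Q 1 by fact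
  note th = T.theta_pos
  let ?\<mu> = "distr M borel T.limit" and ?\<nu> = "distr M1 borel R.limit"
  interpret \<mu>: real_distribution ?\<mu> by simp
  interpret \<nu>: real_distribution ?\<nu> by simp
  interpret \<beta>: real_distribution "beta1 \<theta>" by (rule real_distribution_beta1[OF th])
  note dists = \<mu>.real_distribution_axioms \<nu>.real_distribution_axioms \<beta>.real_distribution_axioms
  define \<kappa> where "\<kappa> = distr (?\<mu> \<Otimes>\<^sub>M (?\<nu> \<Otimes>\<^sub>M beta1 \<theta>)) borel fp_map"
  define b where "b n j = (real j + 1) / (real n + 2)" for n j :: nat
  define S where "S n = distr (measure_pmf (split_pmf \<theta> n)) borel (b n)" for n
  have S: "real_distribution (S n)" for n
    unfolding S_def by (rule real_distribution_split[OF th])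
  have "weak_conv_m S (beta1 \<theta>)"
    using weak_conv_split[OF th] by (simp add: S_def[abs_def] b_def[abs_def])
  from Skorohod[OF S \<beta>.real_distribution_axioms this]
  obtain \<Omega> :: "real measure" and Y :: "nat \<Rightarrow> real \<Rightarrow> real" and Z where
    \<Omega>: "prob_space \<Omega>" and [measurable]: "\<And>n. Y n \<in> borel_measurable \<Omega>" and distr_Y: "\<And>n. distr \<Omega> borel (Y n) = S n"
    and Z: "Z \<in> \<Omega> \<rightarrow>\<^sub>M lborel" and distr_Z: "distr \<Omega> borel Z = beta1 \<theta>"
    and YZ: "\<And>x. x \<in> space \<Omega> \<Longrightarrow> (\<lambda>n. Y n x) \<longlonglongrightarrow> Z x"
    by blast
  interpret \<Omega>: prob_space \<Omega> by fact
  have [measurable]: "Z \<in> borel_measurable \<Omega>"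
    using Z by simp
  \<comment> \<open>Recovers the index from the proportion: for \<open>y = b n j\<close> the floor
    is taken of \<open>j + 1/2\<close>.\<close>
  define J where "J n y = nat \<lfloor>y * (real n + 2) - 1/2\<rfloor>" for n and y :: real
  have J [simp]: "J n (b n j) = j" for n j
  proof -
    have "b n j * (real n + 2) = real j + 1"
      by (simp add: b_def)
    then have "\<lfloor>b n j * (real n + 2) - 1/2\<rfloor> = int j"
      by (simp add: floor_eq_iff)
    then show ?thesis
      by (simp add: J_def)
  qed
  have J_measurable: "J n \<in> borel \<rightarrow>\<^sub>M count_space UNIV" for n
    unfolding J_def by measurable
  have pred: "{y \<in> space borel. J n y \<le> n \<and> y = b n (J n y)} \<in> sets borel" for n
  proof -
    have "{y \<in> space borel. J n y \<le> n \<and> y = b n (J n y)} = b n ` {..n}"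
      by auto
    then show ?thesis
      by (simp only: finite_imp_closed finite_imageI finite_atMost borel_closed)
  qed
  have AE_Y: "AE x in \<Omega>. \<forall>n. J n (Y n x) \<le> n \<and> Y n x = b n (J n (Y n x))"
    unfolding AE_all_countable
  proof
    fix n
    have "AE y in S n. J n y \<le> n \<and> y = b n (J n y)"
      unfolding S_def
    proof (subst AE_distr_iff[OF _ pred])
      have "AE j in measure_pmf (split_pmf \<theta> n). j \<le> n"
        by (rule AE_pmfI) (rule set_split_pmf[OF th])
      then show "AE j in measure_pmf (split_pmf \<theta> n). J n (b n j) \<le> n \<and> b n j = b n (J n (b n j))"
        by simp
    qed simp
    then show "AE x in \<Omega>. J n (Y n x) \<le> n \<and> Y n x = b n (J n (Y n x))"
      unfolding distr_Y[symmetric] by (subst (asm) AE_distr_iff[OF _ pred]) simp_all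
  qed
  have AE_Z: "AE x in \<Omega>. 0 < Z x \<and> Z x < 1"
    using AE_beta1[of \<theta>] unfolding distr_Z[symmetric] by (subst (asm) AE_distr_iff) auto
  have "char \<kappa> t = char ?\<mu> t" for t
  proof (rule LIMSEQ_unique)
    define h where "h n j = growth_char \<theta> (n - j) ((1 - b n j) * t) * growth_char 1 j (b n j * t) * iexp (t * toll (b n j))" for n j
    define H where "H y = char ?\<mu> ((1 - y) * t) * char ?\<nu> (y * t) * iexp (t * toll y)" for y
    have [measurable]: "H \<in> borel_measurable borel"
      unfolding H_def[abs_def] by measurable
    have hJ [measurable]: "(\<lambda>y. h n (J n y)) \<in> borel_measurable borel" for n
      by (rule measurable_compose[OF J_measurable]) simp
    have split: "growth_char \<theta> (Suc n) t = (\<integral>x. h n (J n (Y n x)) \<partial>\<Omega>)" for n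
    proof -
      have "(\<integral>x. h n (J n (Y n x)) \<partial>\<Omega>) = (\<integral>y. h n (J n y) \<partial>S n)"
        unfolding distr_Y[symmetric] by (subst integral_distr) auto
      also have "\<dots> = (\<integral>j. h n (J n (b n j)) \<partial>measure_pmf (split_pmf \<theta> n))"
        unfolding S_def by (subst integral_distr) auto
      also have "\<dots> = (\<Sum>j\<le>n. pmf (split_pmf \<theta> n) j *\<^sub>R h n j)"
        using set_split_pmf[OF th] by (subst integral_measure_pmf[of "{..n}"]) auto
      also have "\<dots> = growth_char \<theta> (Suc n) t"
        unfolding growth_char_split[OF th]
        by (intro sum.cong refl) (simp add: h_def b_def pmf_split_pmf[OF th] scaleR_conv_of_real)
      finally show ?thesis ..
    qed
    show "(\<lambda>n. growth_char \<theta> (Suc n) t) \<longlonglongrightarrow> char \<kappa> t"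
    proof -
      have "(\<lambda>n. \<integral>x. h n (J n (Y n x)) \<partial>\<Omega>) \<longlonglongrightarrow> (\<integral>x. H (Z x) \<partial>\<Omega>)"
      proof (rule integral_dominated_convergence[where w = "\<lambda>_. 1"])
        show "AE x in \<Omega>. norm (h n (J n (Y n x))) \<le> 1" for n
          by (intro AE_I2) (simp add: h_def norm_mult mult_le_one T.norm_growth_char_le R.norm_growth_char_le)
        show "AE x in \<Omega>. (\<lambda>n. h n (J n (Y n x))) \<longlonglongrightarrow> H (Z x)"
          using AE_Y AE_Z AE_space
        proof eventually_elim
          case (elim x)
          define m where "m n = J n (Y n x)" for n
          have Yb: "Y n x = b n (m n)" and m_le: "m n \<le> n" for n
            using elim(1) by (auto simp: m_def)
          have lim: "(\<lambda>n. Y n x) \<longlonglongrightarrow> Z x"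
            by (rule YZ) (rule elim)
          have n_top: "filterlim (\<lambda>n. real n + 2) at_top sequentially"
            by real_asymp
          have shift: "filterlim f at_top sequentially"
            if "filterlim (\<lambda>n. real (f n) + 1) at_top sequentially" for f :: "nat \<Rightarrow> nat"
            using filterlim_tendsto_add_at_top[OF tendsto_const[of "- 1"] that]
            by (simp add: filterlim_sequentially_iff_filterlim_real)
          \<comment> \<open>As \<open>Z x\<close> lies strictly between 0 and 1, both parts grow
            without bound and \<open>growth_char_tendsto\<close> applies to each; the added 1 is the
            offset between index and number of nodes.\<close>
          have "filterlim (\<lambda>n. Y n x * (real n + 2)) at_top sequentially"
            using elim(2) by (intro filterlim_tendsto_pos_mult_at_top[OF lim _ n_top]) simp
          moreover have "Y n x * (real n + 2) = real (m n) + 1" for n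
            unfolding Yb by (simp add: b_def)
          ultimately have m_top: "filterlim m at_top sequentially"
            by (intro shift) simp
          have "filterlim (\<lambda>n. (1 - Y n x) * (real n + 2)) at_top sequentially"
            using elim(2) by (intro filterlim_tendsto_pos_mult_at_top[OF tendsto_diff[OF tendsto_const lim] _ n_top]) simp
          moreover have "(1 - Y n x) * (real n + 2) = real (n - m n) + 1" for n
            unfolding Yb using m_le[of n] by (simp add: b_def field_simps of_nat_diff)
          ultimately have nm_top: "filterlim (\<lambda>n. n - m n) at_top sequentially"
            by (intro shift) simp
          have "isCont toll (Z x)"
            unfolding toll_def[abs_def] using elim(2) by (intro continuous_intros) auto
          then have "(\<lambda>n. toll (Y n x)) \<longlonglongrightarrow> toll (Z x)"
            using lim by (rule isCont_tendsto_compose)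
          then have "(\<lambda>n. growth_char \<theta> (n - m n) ((1 - Y n x) * t) * growth_char 1 (m n) (Y n x * t) * iexp (t * toll (Y n x))) \<longlonglongrightarrow> H (Z x)"
            unfolding H_def
            by (intro tendsto_intros lim T.growth_char_tendsto R.growth_char_tendsto m_top nm_top)
          then show ?case
            unfolding h_def m_def[symmetric] Yb by simp
        qed
      qed measurable
      moreover have "(\<integral>x. H (Z x) \<partial>\<Omega>) = char \<kappa> t"
      proof -
        have "(\<integral>x. H (Z x) \<partial>\<Omega>) = (\<integral>y. H y \<partial>beta1 \<theta>)"
          unfolding distr_Z[symmetric] by (subst integral_distr) auto
        then show ?thesis
          unfolding \<kappa>_def char_fp[OF dists] H_def .
      qed
      ultimately show ?thesis
        by (simp add: split)
    qed
    \<comment> \<open>The same sequence, taken without the split, tends to the characteristic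
      function of the limit itself.\<close>
    show "(\<lambda>n. growth_char \<theta> (Suc n) t) \<longlonglongrightarrow> char ?\<mu> t"
      using T.growth_char_tendsto[OF filterlim_Suc tendsto_const] .
  qed
  then have "char \<kappa> = char ?\<mu>"
    by blast
  then have "\<kappa> = ?\<mu>"
    by (intro Levy_uniqueness) (simp_all add: \<kappa>_def real_distribution_fp[OF dists] \<mu>.real_distribution_axioms)
  then show ?thesis
    by (simp add: fp_solution_def \<kappa>_def)
qed

theorem theorem2p7:
  fixes \<theta> :: real and M :: "'a measure" and P :: "nat \<Rightarrow> 'a \<Rightarrow> nat"
    and M1 :: "'b measure" and Q :: "nat \<Rightarrow> 'b \<Rightarrow> nat"
  assumes "\<theta> > 0"
    and "hoppe_process M P \<theta>"
    and "hoppe_process M1 Q 1"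
  shows "\<exists>X X1.
     X \<in> borel_measurable M \<and> X1 \<in> borel_measurable M1 \<and>
     (AE \<omega> in M. (\<lambda>n. norm_ipl P n \<omega>) \<longlonglongrightarrow> X \<omega>) \<and>
     integrable M (\<lambda>\<omega>. (X \<omega>)\<^sup>2) \<and>
     (\<lambda>n. \<integral>\<omega>. (norm_ipl P n \<omega> - X \<omega>)\<^sup>2 \<partial>M) \<longlonglongrightarrow> 0 \<and>
     \<not> (\<exists>c. AE \<omega> in M. X \<omega> = c) \<and>
     (AE \<omega> in M1. (\<lambda>n. norm_ipl Q n \<omega>) \<longlonglongrightarrow> X1 \<omega>) \<and>
     integrable (distr M borel X) (\<lambda>x. x) \<and>
     fp_solution \<theta> (distr M1 borel X1) (distr M borel X) \<and>
     (\<forall>\<mu>. real_prob_law \<mu> \<and> integrable \<mu> (\<lambda>x. x) \<and> fp_solution \<theta> (distr M1 borel X1) \<mu>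
          \<longrightarrow> \<mu> = distr M borel X) \<and>
     (\<theta> \<noteq> 1 \<longrightarrow> (\<forall>\<mu>. real_prob_law \<mu> \<and> fp_solution \<theta> (distr M1 borel X1) \<mu>
          \<longrightarrow> \<mu> = distr M borel X))"
proof -
  interpret T: hoppe_tree M P \<theta>
    using assms(1,2) by (simp add: hoppe_tree_def hoppe_tree_axioms_def hoppe_process_def)
  interpret R: hoppe_tree M1 Q 1
    using assms(3) by (simp add: hoppe_tree_def hoppe_tree_axioms_def hoppe_process_def)
  have law: "real_prob_law (distr M borel T.limit)" "real_prob_law (distr M1 borel R.limit)"
    by (simp_all add: real_prob_law_def T.prob_space_distr R.prob_space_distr)
  have fp: "fp_solution \<theta> (distr M1 borel R.limit) (distr M borel T.limit)"
    by (rule hoppe_fixed_point[OF T.hoppe_tree_axioms R.hoppe_tree_axioms])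
  have unique: "\<mu> = distr M borel T.limit" if "real_prob_law \<mu>" "fp_solution \<theta> (distr M1 borel R.limit) \<mu>" for \<mu>
    by (rule fp_solution_unique[OF T.theta_pos law(2) that law(1) fp])
  have "integrable (distr M borel T.limit) (\<lambda>x. x)"
    by (simp add: integrable_distr_eq T.integrable_limit)
  then show ?thesis
    using T.borel_measurable_limit R.borel_measurable_limit T.AE_limit R.AE_limit T.integrable_limit_squared
      T.L2_limit T.limit_nondegenerate fp unique
    by (intro exI[of _ T.limit] exI[of _ R.limit] conjI) blast+
qed

end
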